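(* Let $n$ be a positive integer, $\mathbf a\in\{0,1\}^n$, and $\lambda=\lambda(\mathbf a)=(a_1+\cdots+a_n,\ldots,a_1+a_2,a_1)$. Regarding $|\lambda|!\cdot v^{(n,m)}(\mathbf a,\mathbf 0)$ as a polynomial in $m$, its leading term (the coefficient of $m^{|\lambda|}$) is $p_{\mathbf a,\mathbf 0,|\lambda|}$, and $p_{\mathbf a,\mathbf 0,|\lambda|}$ equals the number of standard Young tableaux of the shifted skew shape $\nu/\rho$.
   Context: $v^{(n,m)}(\mathbf a,\mathbf 0)$ is the number of vertices of the flow polytope $\mathcal F_{G(n,m)}(\mathbf a)$, where $G(n,m)$ has vertices $\{(i,j):1\le i\le n,0\le j\le m\}\cup\{s\}$ and edges $((i,j),(i,j+1))$ ($1\le i\le n$, $0\le j\le m-1$), $((i,j),(i+1,j))$ ($1\le i\le n-1$, $0\le j\le m$), $((n,j),s)$ ($0\le j\le m$), and the polytope consists of nonnegative edge weightings with outflow minus inflow equal to $a_i$ at $(i,0)$, $-\sum a_i$ at $s$, $0$ elsewhere. It is a polynomial in $m$. $p_{\mathbf a,\mathbf 0,k}$ is the number of vertex plane partitions of shape $\lambda$ with entries at most $k-1$ in which every value $0,\dots,k-1$ occurs; so $p_{\mathbf a,\mathbf 0,|\lambda|}$ counts vertex plane partitions of shape $\lambda$ with distinct entries $0,\dots,|\lambda|-1$. A plane partition of shape $\lambda$ is a filling by nonnegative integers weakly decreasing along rows and down columns. With $\lambda'_j=\#\{i:\lambda_i\ge j\}$ and $\pi_{i,j}$ the entry in row $i$,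 column $j$ (column $j$ = rows $1\le i\le\lambda'_j$; here $\mu=0$ so $\mu'_j=0$), $\pi$ is a vertex plane partition if for all adjacent columns $j,j+1$: (i) if $\lambda'_j=\lambda'_{j+1}$: $\pi_{i,j}=\pi_{i,j+1}$ for all $i$; (ii) if $\lambda'_j>\lambda'_{j+1}$: $\pi_{i,j}=\pi_{i,j+1}$ for some $2\le i\le\lambda'_{j+1}$ implies $\pi_{i-1,j}=\pi_{i-1,j+1}$; and for every $1\le i\le\lambda'_{j+1}$, $\pi_{i,j+1}<\pi_{i+1,j}$ or $\pi_{i,j+1}=\pi_{i,j}$. The shifted skew shape $\nu/\rho$ is the shifted skew shape with the same column lengths, read from right to left, as $\lambda$: concretely, with the shifted staircase $\{(r,k):1\le r\le k\le n\}$ (row $r$, column $k$), $\nu/\rho$ is the set of cells $(r,k)$ with $k-\lambda'_{n+1-k}<r\le k$ (with $\lambda'_c=0$ for $c>\lambda_1$). A standard Young tableau of shape $\nu/\rho$ is a bijective filling of its cells with $1,\dots,|\lambda|$ increasing along rows and down columns. *)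

theory Defs
  imports "HOL-Computational_Algebra.Polynomial"
begin

text \<open>Vertices: Some (i,j) stands for (i,j), None stands for the sink s.\<close>
type_synonym gvert = "(nat \<times> nat) option"
type_synonym gedge = "gvert \<times> gvert"

definition G_verts :: "nat \<Rightarrow> nat \<Rightarrow> gvert set" where
  "G_verts n m = {Some (i, j) | i j. 1 \<le> i \<and> i \<le> n \<and> j \<le> m} \<union> {None}"

definition G_edges :: "nat \<Rightarrow> nat \<Rightarrow> gedge set" where
  "G_edges n m =
     {(Some (i, j), Some (i, j + 1)) | i j. 1 \<le> i \<and> i \<le> n \<and> j < m}
   \<union> {(Some (i, j), Some (i + 1, j)) | i j. 1 \<le> i \<and> i < n \<and> j \<le> m}
   \<union> {(Some (n, j), None) | j. j \<le> m}"

definition demand :: "nat \<Rightarrow> (nat \<Rightarrow> nat) \<Rightarrow> gvert \<Rightarrow> real" where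
  "demand n a v = (case v of
      None \<Rightarrow> - (\<Sum>i=1..n. real (a i))
    | Some (i, j) \<Rightarrow> (if j = 0 then real (a i) else 0))"

text \<open>Edge weightings are functions on all pairs, vanishing off the edge set
  (so they are identified with vectors in R^E).\<close>
definition flow_polytope :: "nat \<Rightarrow> nat \<Rightarrow> (nat \<Rightarrow> nat) \<Rightarrow> (gedge \<Rightarrow> real) set" where
  "flow_polytope n m a =
     {x. (\<forall>e. e \<notin> G_edges n m \<longrightarrow> x e = 0)
       \<and> (\<forall>e\<in>G_edges n m. 0 \<le> x e)
       \<and> (\<forall>v\<in>G_verts n m.
             (\<Sum>e\<in>{e\<in>G_edges n m. fst e = v}. x e)
           - (\<Sum>e\<in>{e\<in>G_edges n m. snd e = v}. x e) = demand n a v)}"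

definition is_vertex :: "('e \<Rightarrow> real) set \<Rightarrow> ('e \<Rightarrow> real) \<Rightarrow> bool" where
  "is_vertex P x \<longleftrightarrow> x \<in> P \<and>
     (\<forall>y\<in>P. \<forall>z\<in>P. \<forall>u::real. y \<noteq> z \<and> 0 < u \<and> u < 1 \<longrightarrow>
        x \<noteq> (\<lambda>e. (1 - u) * y e + u * z e))"

definition num_vertices :: "nat \<Rightarrow> nat \<Rightarrow> (nat \<Rightarrow> nat) \<Rightarrow> nat" where
  "num_vertices n m a = card {x. is_vertex (flow_polytope n m a) x}"

definition lam :: "nat \<Rightarrow> (nat \<Rightarrow> nat) \<Rightarrow> nat \<Rightarrow> nat" where
  "lam n a k = (if 1 \<le> k \<and> k \<le> n then (\<Sum>i=1..n+1-k. a i) else 0)"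

definition lam_size :: "nat \<Rightarrow> (nat \<Rightarrow> nat) \<Rightarrow> nat" where
  "lam_size n a = (\<Sum>k=1..n. lam n a k)"

definition lam_conj :: "nat \<Rightarrow> (nat \<Rightarrow> nat) \<Rightarrow> nat \<Rightarrow> nat" where
  "lam_conj n a j = card {i. 1 \<le> i \<and> i \<le> n \<and> j \<le> lam n a i}"

definition in_shape :: "nat \<Rightarrow> (nat \<Rightarrow> nat) \<Rightarrow> nat \<Rightarrow> nat \<Rightarrow> bool" where
  "in_shape n a i j \<longleftrightarrow> 1 \<le> i \<and> i \<le> n \<and> 1 \<le> j \<and> j \<le> lam n a i"

text \<open>Plane partition of shape lambda: pi i j is the entry in row i, column j;
  it is 0 outside the shape (normalisation so that fillings are counted once).\<close>
definition plane_partition :: "nat \<Rightarrow> (nat \<Rightarrow> nat) \<Rightarrow> (nat \<Rightarrow> nat \<Rightarrow> nat) \<Rightarrow> bool" where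
  "plane_partition n a \<pi> \<longleftrightarrow>
     (\<forall>i j. \<not> in_shape n a i j \<longrightarrow> \<pi> i j = 0)
   \<and> (\<forall>i j. in_shape n a i j \<and> in_shape n a i (j + 1) \<longrightarrow> \<pi> i (j + 1) \<le> \<pi> i j)
   \<and> (\<forall>i j. in_shape n a i j \<and> in_shape n a (i + 1) j \<longrightarrow> \<pi> (i + 1) j \<le> \<pi> i j)"

definition vertex_plane_partition :: "nat \<Rightarrow> (nat \<Rightarrow> nat) \<Rightarrow> (nat \<Rightarrow> nat \<Rightarrow> nat) \<Rightarrow> bool" where
  "vertex_plane_partition n a \<pi> \<longleftrightarrow> plane_partition n a \<pi> \<and>
     (\<forall>j\<ge>1.
        (lam_conj n a j = lam_conj n a (j + 1) \<longrightarrow>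
           (\<forall>i. 1 \<le> i \<and> i \<le> lam_conj n a j \<longrightarrow> \<pi> i j = \<pi> i (j + 1)))
      \<and> (lam_conj n a j > lam_conj n a (j + 1) \<longrightarrow>
           (\<forall>i. 2 \<le> i \<and> i \<le> lam_conj n a (j + 1) \<and> \<pi> i j = \<pi> i (j + 1) \<longrightarrow>
                 \<pi> (i - 1) j = \<pi> (i - 1) (j + 1))
         \<and> (\<forall>i. 1 \<le> i \<and> i \<le> lam_conj n a (j + 1) \<longrightarrow>
                 \<pi> i (j + 1) < \<pi> (i + 1) j \<or> \<pi> i (j + 1) = \<pi> i j)))"

definition p_count :: "nat \<Rightarrow> (nat \<Rightarrow> nat) \<Rightarrow> nat \<Rightarrow> nat" where
  "p_count n a k = card {\<pi>. vertex_plane_partition n a \<pi>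
      \<and> (\<forall>i j. in_shape n a i j \<longrightarrow> \<pi> i j < k)
      \<and> (\<forall>v<k. \<exists>i j. in_shape n a i j \<and> \<pi> i j = v)}"

definition shifted_cells :: "nat \<Rightarrow> (nat \<Rightarrow> nat) \<Rightarrow> (nat \<times> nat) set" where
  "shifted_cells n a = {(r, k). 1 \<le> r \<and> r \<le> k \<and> k \<le> n
                                \<and> int k - int (lam_conj n a (n + 1 - k)) < int r}"

definition SYT_shifted :: "nat \<Rightarrow> (nat \<Rightarrow> nat) \<Rightarrow> (nat \<times> nat \<Rightarrow> nat) set" where
  "SYT_shifted n a = {T. bij_betw T (shifted_cells n a) {1..card (shifted_cells n a)}
      \<and> (\<forall>c. c \<notin> shifted_cells n a \<longrightarrow> T c = 0)
      \<and> (\<forall>r k k'. (r, k) \<in> shifted_cells n a \<and> (r, k') \<in> shifted_cells n a \<and> k < k'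
                  \<longrightarrow> T (r, k) < T (r, k'))
      \<and> (\<forall>r r' k. (r, k) \<in> shifted_cells n a \<and> (r', k) \<in> shifted_cells n a \<and> r < r'
                  \<longrightarrow> T (r, k) < T (r', k))}"

end

theory Submission
  imports Defs "HOL-Library.FuncSet" "HOL-Library.Infinite_Set"
begin

text \<open>A flow on a directed acyclic graph with a single sink is a vertex of its flow polytope iff its
  support has out-degree at most one everywhere: two outgoing edges at one vertex extend to two
  routes to the sink, and the flow can be moved both ways along their difference.
  On \<open>G(n,m)\<close> such a flow is a family of lattice paths, one from each \<open>(i,0)\<close> with \<open>a\<^sub>i = 1\<close>, which
  stay together once they have met. Recording the columns at which the paths leave the rows
  gives exactly the vertex plane partitions with entries at most \<open>m\<close>.

  Being a vertex plane partition depends only on the relative order of the entries, so there are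
  \<open>\<Sum>k. (m + 1 choose k) * p\<^sub>k\<close> of them, and the leading term comes from \<open>k = |\<lambda>|\<close>. When the entries
  are distinct, the conditions become \<open>\<pi> (i + 1) j < \<pi> i j\<close> and \<open>\<pi> i (j + 1) < \<pi> (i + 1) j\<close>; these
  are the inequalities of a standard tableau of the shifted shape.\<close>

section \<open>Vertices of flow polytopes of acyclic networks\<close>

definition netflow :: "('v \<times> 'v) set \<Rightarrow> ('v \<times> 'v \<Rightarrow> real) \<Rightarrow> 'v \<Rightarrow> real" where
  "netflow E x v = (\<Sum>e\<in>{e\<in>E. fst e = v}. x e) - (\<Sum>e\<in>{e\<in>E. snd e = v}. x e)"

definition flows :: "('v \<times> 'v) set \<Rightarrow> 'v set \<Rightarrow> ('v \<Rightarrow> real) \<Rightarrow> ('v \<times> 'v \<Rightarrow> real) set" where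
  "flows E V b = {x. (\<forall>e. e \<notin> E \<longrightarrow> x e = 0) \<and> (\<forall>e\<in>E. 0 \<le> x e) \<and> (\<forall>v\<in>V. netflow E x v = b v)}"

definition confluent :: "('v \<times> 'v) set \<Rightarrow> ('v \<times> 'v \<Rightarrow> real) \<Rightarrow> bool" where
  "confluent E x \<longleftrightarrow> (\<forall>e\<in>E. \<forall>e'\<in>E. fst e = fst e' \<and> x e > 0 \<and> x e' > 0 \<longrightarrow> e = e')"

lemma netflow_add: "netflow E (\<lambda>e. x e + y e) v = netflow E x v + netflow E y v"
  by (simp add: netflow_def sum.distrib)

lemma netflow_diff: "netflow E (\<lambda>e. x e - y e) v = netflow E x v - netflow E y v"
  by (simp add: netflow_def sum_subtractf)

lemma netflow_mult: "netflow E (\<lambda>e. c * x e) v = c * netflow E x v"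
  by (simp add: netflow_def sum_distrib_left right_diff_distrib)

lemma netflow_sum: "netflow E (\<lambda>e. \<Sum>i\<in>I. f i e) v = (\<Sum>i\<in>I. netflow E (f i) v)"
  by (simp add: netflow_def sum_subtractf sum.swap[of _ I])

lemma netflow_single_edge:
  assumes "finite E" "d \<in> E"
  shows "netflow E (\<lambda>e. of_bool (e = d)) v = of_bool (fst d = v) - of_bool (snd d = v)"
proof -
  have *: "(\<Sum>e\<in>{e\<in>E. P e}. of_bool (e = d)) = (of_bool (P d) :: real)" for P
    using assms by (auto simp: of_bool_def sum.delta)
  show ?thesis unfolding netflow_def by (simp add: *)
qed

lemma finite_positive_lower_bound:
  fixes f :: "'a \<Rightarrow> real"
  assumes "finite A" "\<And>e. e \<in> A \<Longrightarrow> f e > 0"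
  shows "\<exists>\<epsilon>>0. \<forall>e\<in>A. \<epsilon> \<le> f e"
  using assms
proof (induction A rule: finite_induct)
  case empty
  then show ?case by (auto intro: exI[of _ 1])
next
  case (insert a A)
  then obtain \<epsilon> where "\<epsilon> > 0" "\<forall>e\<in>A. \<epsilon> \<le> f e" by auto
  then show ?case using insert.prems[of a] by (intro exI[of _ "min \<epsilon> (f a)"]) auto
qed

locale dag_network =
  fixes E :: "('v \<times> 'v) set" and V :: "'v set" and b :: "'v \<Rightarrow> real"
    and s :: 'v and pot :: "'v \<Rightarrow> nat" and K :: nat
  assumes finite_E: "finite E"
    and edge_V: "e \<in> E \<Longrightarrow> fst e \<in> V \<and> snd e \<in> V"
    and pot_less: "e \<in> E \<Longrightarrow> pot (fst e) < pot (snd e)"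
    and pot_bound: "v \<in> V \<Longrightarrow> pot v \<le> K"
    and b_nonneg: "v \<in> V \<Longrightarrow> v \<noteq> s \<Longrightarrow> 0 \<le> b v"
begin

text \<open>On a support with out-degree at most one, the flow on an edge is forced by the flow into
  its tail.\<close>
lemma confluent_support_unique:
  assumes x: "confluent E x" and y: "y \<in> flows E V b" and z: "z \<in> flows E V b"
    and ys: "\<And>e. e \<in> E \<Longrightarrow> y e \<noteq> 0 \<Longrightarrow> x e > 0"
    and zs: "\<And>e. e \<in> E \<Longrightarrow> z e \<noteq> 0 \<Longrightarrow> x e > 0"
  shows "y = z"
proof -
  have "y e = z e" if "e \<in> E" for e
    using that
  proof (induction "pot (fst e)" arbitrary: e rule: less_induct)
    case less
    define v where "v = fst e"
    have vV: "v \<in> V" using less.prems edge_V v_def by blast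
    have inflow: "(\<Sum>e\<in>{e\<in>E. snd e = v}. y e) = (\<Sum>e\<in>{e\<in>E. snd e = v}. z e)"
    proof (rule sum.cong[OF refl])
      fix e' assume e': "e' \<in> {e\<in>E. snd e = v}"
      then show "y e' = z e'" using less.hyps[of e'] pot_less[of e'] v_def by auto
    qed
    have outflow: "(\<Sum>e\<in>{e\<in>E. fst e = v}. y e) = (\<Sum>e\<in>{e\<in>E. fst e = v}. z e)"
      using y z vV inflow unfolding flows_def netflow_def by force
    show ?case
    proof (cases "x e > 0")
      case True
      have other: "y e' = 0 \<and> z e' = 0" if "e' \<in> {e\<in>E. fst e = v} - {e}" for e'
        using that x less.prems True ys[of e'] zs[of e'] unfolding confluent_def v_def by blast
      have eq: "(\<Sum>e\<in>{e\<in>E. fst e = v}. w e) = w e"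
        if "\<And>e'. e' \<in> {e\<in>E. fst e = v} - {e} \<Longrightarrow> w e' = 0" for w :: "'v \<times> 'v \<Rightarrow> real"
        using sum.mono_neutral_right[of "{e\<in>E. fst e = v}" "{e}" w] that finite_E less.prems v_def
        by auto
      show ?thesis using eq[of y] eq[of z] other outflow by auto
    next
      case False
      then show ?thesis using ys[of e] zs[of e] less.prems by metis
    qed
  qed
  moreover have "y e = z e" if "e \<notin> E" for e using y z that by (cases e) (simp add: flows_def)
  ultimately show ?thesis by blast
qed

lemma unit_flow_to_sink:
  assumes x: "x \<in> flows E V b" and d: "d \<in> E" "x d > 0"
  shows "\<exists>f. (\<forall>e. f e \<noteq> 0 \<longrightarrow> e \<in> E \<and> x e > 0 \<and> pot (snd d) \<le> pot (fst e)) \<and>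
             (\<forall>v. netflow E f v = of_bool (v = snd d) - of_bool (v = s))"
  using d
proof (induction "K - pot (snd d)" arbitrary: d rule: less_induct)
  case less
  define w where "w = snd d"
  show ?case
  proof (cases "w = s")
    case True
    then show ?thesis
      by (intro exI[of _ "\<lambda>_. 0"]) (auto simp: netflow_def w_def)
  next
    case False
    have wV: "w \<in> V" using edge_V less.prems w_def by auto
    have nn: "\<And>e. e \<in> E \<Longrightarrow> 0 \<le> x e" using x by (auto simp: flows_def)
    have "x d \<le> (\<Sum>e\<in>{e\<in>E. snd e = w}. x e)"
      using less.prems w_def nn finite_E by (intro member_le_sum) auto
    moreover have "(\<Sum>e\<in>{e\<in>E. fst e = w}. x e) \<ge> (\<Sum>e\<in>{e\<in>E. snd e = w}. x e)"
      using x wV b_nonneg[OF wV False] unfolding flows_def netflow_def by force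
    ultimately have "(\<Sum>e\<in>{e\<in>E. fst e = w}. x e) \<noteq> 0" using less.prems by simp
    then obtain d' where d': "d' \<in> E" "fst d' = w" "x d' \<noteq> 0"
      by (metis (mono_tags, lifting) mem_Collect_eq sum.neutral)
    then have xd': "x d' > 0" using nn[of d'] by simp
    have p: "pot w < pot (snd d')" using pot_less[of d'] d' by simp
    have "K - pot (snd d') < K - pot (snd d)"
      using p pot_bound[of "snd d'"] edge_V[of d'] d' unfolding w_def by auto
    from less.hyps[OF this d'(1) xd'] obtain f where
      f: "\<forall>e. f e \<noteq> 0 \<longrightarrow> e \<in> E \<and> x e > 0 \<and> pot (snd d') \<le> pot (fst e)"
         "\<forall>v. netflow E f v = of_bool (v = snd d') - of_bool (v = s)" by blast
    show ?thesis
    proof (intro exI[of _ "\<lambda>e. f e + of_bool (e = d')"] conjI allI impI)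
      fix e assume e: "f e + of_bool (e = d') \<noteq> 0"
      have *: "f e \<noteq> 0 \<or> e = d'"
      proof (rule ccontr)
        assume "\<not> ?thesis" then show False using e by simp
      qed
      from * show "e \<in> E" "0 < x e" "pot (snd d) \<le> pot (fst e)"
        using f(1)[rule_format, of e] d' xd' p unfolding w_def by auto
    next
      fix v show "netflow E (\<lambda>e. f e + of_bool (e = d')) v = of_bool (v = snd d) - of_bool (v = s)"
        using d' unfolding netflow_add netflow_single_edge[OF finite_E d'(1)]
        by (auto simp: f w_def)
    qed
  qed
qed

lemma vertex_imp_confluent:
  assumes x: "is_vertex (flows E V b) x"
  shows "confluent E x"
proof (rule ccontr)
  assume "\<not> confluent E x"
  then obtain d1 d2 where d: "d1 \<in> E" "d2 \<in> E" "fst d1 = fst d2" "x d1 > 0" "x d2 > 0" "d1 \<noteq> d2"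
    by (auto simp: confluent_def)
  have xP: "x \<in> flows E V b" using x by (simp add: is_vertex_def)
  obtain f1 where f1: "\<forall>e. f1 e \<noteq> 0 \<longrightarrow> e \<in> E \<and> x e > 0 \<and> pot (snd d1) \<le> pot (fst e)"
     "\<forall>v. netflow E f1 v = of_bool (v = snd d1) - of_bool (v = s)"
    using unit_flow_to_sink[OF xP d(1,4)] by blast
  obtain f2 where f2: "\<forall>e. f2 e \<noteq> 0 \<longrightarrow> e \<in> E \<and> x e > 0 \<and> pot (snd d2) \<le> pot (fst e)"
     "\<forall>v. netflow E f2 v = of_bool (v = snd d2) - of_bool (v = s)"
    using unit_flow_to_sink[OF xP d(2,5)] by blast
  define g where "g = (\<lambda>e. (f1 e + of_bool (e = d1)) - (f2 e + of_bool (e = d2)))"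
  have g0: "netflow E g v = 0" for v
    using d f1 f2 unfolding g_def netflow_add netflow_diff
      netflow_single_edge[OF finite_E d(1)] netflow_single_edge[OF finite_E d(2)]
    by (auto simp: of_bool_def)
  have supp: "e \<in> E \<and> x e > 0" if "g e \<noteq> 0" for e
  proof (rule ccontr)
    assume n: "\<not> ?thesis"
    then have "f1 e = 0" "f2 e = 0" "e \<noteq> d1" "e \<noteq> d2" using f1 f2 d by blast+
    then show False using that by (simp add: g_def)
  qed
  have "f1 d1 = 0" "f2 d1 = 0"
    using f1(1)[rule_format, of d1] f2(1)[rule_format, of d1] pot_less[of d1] pot_less[of d2] d
    by force+
  then have gd: "g d1 = 1" using d by (simp add: g_def)
  obtain \<epsilon> where eps: "\<epsilon> > 0" "\<forall>e\<in>{e\<in>E. x e > 0}. \<epsilon> \<le> x e / (1 + \<bar>g e\<bar>)"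
    using finite_positive_lower_bound[of "{e\<in>E. x e > 0}" "\<lambda>e. x e / (1 + \<bar>g e\<bar>)"] finite_E
    by (auto intro: divide_pos_pos add_pos_nonneg)
  have small: "\<epsilon> * \<bar>g e\<bar> \<le> x e" if "e \<in> E" for e
  proof (cases "g e = 0")
    case True then show ?thesis using that xP by (auto simp: flows_def)
  next
    case False
    then have "\<epsilon> \<le> x e / (1 + \<bar>g e\<bar>)" using eps supp by blast
    then have "\<epsilon> * (1 + \<bar>g e\<bar>) \<le> x e" by (simp add: pos_le_divide_eq add_pos_nonneg)
    then show ?thesis using eps by (simp add: algebra_simps)
  qed
  have inP: "(\<lambda>e. x e + t * g e) \<in> flows E V b" if "\<bar>t\<bar> = \<epsilon>" for t
  proof -
    have "0 \<le> x e + t * g e" if e: "e \<in> E" for e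
    proof -
      have "\<bar>t * g e\<bar> \<le> x e" using small[OF e] \<open>\<bar>t\<bar> = \<epsilon>\<close> by (simp add: abs_mult)
      then show ?thesis by linarith
    qed
    moreover have "netflow E (\<lambda>e. x e + t * g e) v = netflow E x v" for v
      by (simp add: netflow_add netflow_mult g0)
    moreover have "g e = 0" if "e \<notin> E" for e using supp that by blast
    ultimately show ?thesis using xP by (simp add: flows_def)
  qed
  have ne: "(\<lambda>e. x e + \<epsilon> * g e) \<noteq> (\<lambda>e. x e + (- \<epsilon>) * g e)"
  proof
    assume "(\<lambda>e. x e + \<epsilon> * g e) = (\<lambda>e. x e + (- \<epsilon>) * g e)"
    from fun_cong[OF this, of d1] show False using gd eps by simp
  qed
  have "x = (\<lambda>e. (1 - 1/2) * (x e + \<epsilon> * g e) + 1/2 * (x e + (- \<epsilon>) * g e))"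
    by (auto simp: algebra_simps)
  moreover have "x \<noteq> (\<lambda>e. (1 - 1/2) * (x e + \<epsilon> * g e) + 1/2 * (x e + (- \<epsilon>) * g e))"
    using x[unfolded is_vertex_def, THEN conjunct2, rule_format,
        OF inP[of \<epsilon>] inP[of "- \<epsilon>"], of "1/2"] ne eps by force
  ultimately show False by blast
qed

lemma confluent_imp_vertex:
  assumes x: "x \<in> flows E V b" "confluent E x"
  shows "is_vertex (flows E V b) x"
  unfolding is_vertex_def
proof (intro conjI ballI allI impI x notI)
  fix y z and u :: real
  assume y: "y \<in> flows E V b" and z: "z \<in> flows E V b" and u: "y \<noteq> z \<and> 0 < u \<and> u < 1"
    and eq: "x = (\<lambda>e. (1 - u) * y e + u * z e)"
  have nn: "0 \<le> y e" "0 \<le> z e" if "e \<in> E" for e using y z that by (auto simp: flows_def)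
  have "x e > 0" if e: "e \<in> E" "y e \<noteq> 0" for e
  proof -
    have "(1 - u) * y e > 0" using u e nn[OF e(1)] by simp
    then show ?thesis using u nn[OF e(1)] unfolding eq by (simp add: add_pos_nonneg)
  qed
  moreover have "x e > 0" if e: "e \<in> E" "z e \<noteq> 0" for e
  proof -
    have "u * z e > 0" using u e nn[OF e(1)] by simp
    then show ?thesis using u nn[OF e(1)] unfolding eq by (simp add: add_nonneg_pos)
  qed
  ultimately show False using confluent_support_unique[OF x(2) y z] u by blast
qed

lemma vertex_iff_confluent:
  "is_vertex (flows E V b) x \<longleftrightarrow> x \<in> flows E V b \<and> confluent E x"
  using vertex_imp_confluent confluent_imp_vertex unfolding is_vertex_def by blast

end

section \<open>Vertex plane partitions\<close>

locale zero_one_netflow =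
  fixes n :: nat and a :: "nat \<Rightarrow> nat"
  assumes n_pos: "1 \<le> n" and a_le_1: "1 \<le> i \<Longrightarrow> i \<le> n \<Longrightarrow> a i \<le> 1"
begin

abbreviation shape :: "nat \<Rightarrow> nat \<Rightarrow> bool" where "shape \<equiv> in_shape n a"

lemma lam_step: "1 \<le> k \<Longrightarrow> k \<le> n \<Longrightarrow> lam n a k = lam n a (k + 1) + a (n + 1 - k)"
proof -
  assume k: "1 \<le> k" "k \<le> n"
  then obtain d where d: "n = k + d" using le_Suc_ex by blast
  show ?thesis using k unfolding d lam_def by (cases d) auto
qed

lemma lam_antimono: "k \<le> k' \<Longrightarrow> 1 \<le> k \<Longrightarrow> lam n a k' \<le> lam n a k"
proof (induction k' rule: dec_induct)
  case (step k')
  then show ?case using lam_step[of k'] by (cases "k' \<le> n") (auto simp: lam_def)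
qed simp

lemma shape_up: "shape (i + 1) j \<Longrightarrow> 1 \<le> i \<Longrightarrow> shape i j"
  using lam_antimono[of i "i + 1"] by (auto simp: in_shape_def)

lemma shape_left: "shape i (j + 1) \<Longrightarrow> 1 \<le> j \<Longrightarrow> shape i j"
  by (auto simp: in_shape_def)

lemma shape_diag: 
  assumes "shape i (j + 1)" "1 \<le> j"
  shows "shape (i + 1) j"
proof -
  have "i + 1 \<le> n"
  proof (rule ccontr)
    assume "\<not> i + 1 \<le> n"
    then have "i = n" using assms by (auto simp: in_shape_def)
    then show False using assms a_le_1[of 1] n_pos by (auto simp: in_shape_def lam_def)
  qed
  moreover have "a (n + 1 - i) \<le> 1" using assms by (intro a_le_1) (auto simp: in_shape_def)
  ultimately show ?thesis using assms lam_step[of i] by (auto simp: in_shape_def)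
qed

lemma shape_bound: "shape i j \<Longrightarrow> i + j \<le> n + 1"
proof (induction j arbitrary: i)
  case (Suc j)
  show ?case
  proof (cases "j = 0")
    case True then show ?thesis using Suc.prems by (auto simp: in_shape_def)
  next
    case False
    then show ?thesis using Suc.IH[of "i + 1"] shape_diag[of i j] Suc.prems by simp
  qed
qed (auto simp: in_shape_def)

lemma shape_iff_lam_conj:
  assumes "1 \<le> j"
  shows "shape i j \<longleftrightarrow> 1 \<le> i \<and> i \<le> lam_conj n a j"
proof -
  define D where "D = {i. 1 \<le> i \<and> i \<le> n \<and> j \<le> lam n a i}"
  have fin: "finite D" unfolding D_def by (rule finite_subset[of _ "{1..n}"]) auto
  have down: "i' \<in> D" if "i \<in> D" "1 \<le> i'" "i' \<le> i" for i i'
    using that lam_antimono[of i' i] unfolding D_def by auto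
  obtain h where h: "D = {1..h}"
  proof (cases "D = {}")
    case True then show ?thesis using that[of 0] by simp
  next
    case False
    have "D = {1..Max D}"
    proof
      show "D \<subseteq> {1..Max D}" using Max_ge[OF fin] by (auto simp: D_def)
      show "{1..Max D} \<subseteq> D" using down[OF Max_in[OF fin False]] by auto
    qed
    then show ?thesis by (rule that)
  qed
  have "lam_conj n a j = h" unfolding lam_conj_def D_def[symmetric] by (simp add: h)
  then have "i \<in> D \<longleftrightarrow> 1 \<le> i \<and> i \<le> lam_conj n a j" by (simp add: h)
  then show ?thesis using assms by (auto simp: in_shape_def D_def)
qed

lemma lam_conj_strict:
  assumes "1 \<le> j" "1 \<le> lam_conj n a (j + 1)"
  shows "lam_conj n a (j + 1) < lam_conj n a j"
proof -
  have "shape (lam_conj n a (j + 1)) (j + 1)" using assms by (simp add: shape_iff_lam_conj)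
  from shape_diag[OF this assms(1)] show ?thesis using assms by (simp add: shape_iff_lam_conj)
qed

lemma vertex_plane_partition_iff:
  "vertex_plane_partition n a \<pi> \<longleftrightarrow>
     (\<forall>i j. \<not> shape i j \<longrightarrow> \<pi> i j = 0) \<and>
     (\<forall>i j. 1 \<le> i \<and> shape (i + 1) j \<longrightarrow> \<pi> (i + 1) j \<le> \<pi> i j) \<and>
     (\<forall>i j. 1 \<le> j \<and> shape i (j + 1) \<longrightarrow> \<pi> i (j + 1) < \<pi> (i + 1) j \<or> \<pi> i (j + 1) = \<pi> i j)"
  (is "?L \<longleftrightarrow> ?Z \<and> ?C \<and> ?V")
proof
  assume L: ?L
  have "\<pi> i (j + 1) < \<pi> (i + 1) j \<or> \<pi> i (j + 1) = \<pi> i j" if "1 \<le> j" "shape i (j + 1)" for i j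
  proof -
    have i: "1 \<le> i" "i \<le> lam_conj n a (j + 1)" using that by (simp_all add: shape_iff_lam_conj)
    then have "lam_conj n a (j + 1) < lam_conj n a j" using that lam_conj_strict[of j] by auto
    then show ?thesis using L i that unfolding vertex_plane_partition_def by blast
  qed
  moreover have pp: "plane_partition n a \<pi>" using L by (simp add: vertex_plane_partition_def)
  moreover have "\<pi> (i + 1) j \<le> \<pi> i j" if "1 \<le> i" "shape (i + 1) j" for i j
    using pp that shape_up[OF that(2,1)] unfolding plane_partition_def by blast
  moreover have "\<pi> i j = 0" if "\<not> shape i j" for i j
    using pp that unfolding plane_partition_def by blast
  ultimately show "?Z \<and> ?C \<and> ?V" by blast
next
  assume R: "?Z \<and> ?C \<and> ?V"
  have row: "\<pi> i (j + 1) \<le> \<pi> i j" if "shape i j" "shape i (j + 1)" for i j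
  proof -
    have j: "1 \<le> j" "1 \<le> i" using that by (auto simp: in_shape_def)
    then have "\<pi> (i + 1) j \<le> \<pi> i j" using R shape_diag[of i j] that by blast
    moreover have "\<pi> i (j + 1) < \<pi> (i + 1) j \<or> \<pi> i (j + 1) = \<pi> i j" using R j that by blast
    ultimately show ?thesis by linarith
  qed
  have pp: "plane_partition n a \<pi>"
    unfolding plane_partition_def
  proof (intro conjI allI impI)
    fix i j assume "shape i j \<and> shape (i + 1) j"
    then show "\<pi> (i + 1) j \<le> \<pi> i j" using R by (simp add: in_shape_def)
  qed (use R row in blast)+
  have v2: "\<pi> (i - 1) j = \<pi> (i - 1) (j + 1)"
    if "1 \<le> j" "2 \<le> i" "i \<le> lam_conj n a (j + 1)" "\<pi> i j = \<pi> i (j + 1)" for i j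
  proof -
    define k where "k = i - 1"
    have k: "i = k + 1" "1 \<le> k" using \<open>2 \<le> i\<close> by (auto simp: k_def)
    have s: "shape (k + 1) (j + 1)" using that k by (simp add: shape_iff_lam_conj)
    then have "\<pi> (k + 1) (j + 1) \<le> \<pi> k (j + 1)" using R k by blast
    moreover have "\<pi> k (j + 1) < \<pi> (k + 1) j \<or> \<pi> k (j + 1) = \<pi> k j"
      using R shape_up[OF s k(2)] that(1) by blast
    ultimately show ?thesis using that k by auto
  qed
  show ?L
    unfolding vertex_plane_partition_def
  proof (intro conjI allI impI pp)
    fix j i assume "1 \<le> j" "lam_conj n a j = lam_conj n a (j + 1)" "1 \<le> i \<and> i \<le> lam_conj n a j"
    then show "\<pi> i j = \<pi> i (j + 1)" using lam_conj_strict[of j] by auto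
  next
    fix j i assume "1 \<le> j" "2 \<le> i \<and> i \<le> lam_conj n a (j + 1) \<and> \<pi> i j = \<pi> i (j + 1)"
    then show "\<pi> (i - 1) j = \<pi> (i - 1) (j + 1)" using v2 by blast
  next
    fix j i assume "1 \<le> j" "1 \<le> i \<and> i \<le> lam_conj n a (j + 1)"
    then show "\<pi> i (j + 1) < \<pi> (i + 1) j \<or> \<pi> i (j + 1) = \<pi> i j"
      using R by (simp add: shape_iff_lam_conj)
  qed
qed

abbreviation vpp :: "(nat \<Rightarrow> nat \<Rightarrow> nat) \<Rightarrow> bool" where "vpp \<equiv> vertex_plane_partition n a"

definition entries :: "(nat \<Rightarrow> nat \<Rightarrow> nat) \<Rightarrow> nat set" where
  "entries \<pi> = {\<pi> i j | i j. shape i j}"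

lemma vpp_outside: "vpp \<pi> \<Longrightarrow> \<not> shape i j \<Longrightarrow> \<pi> i j = 0"
  by (simp add: vertex_plane_partition_iff)

lemma vpp_column: "vpp \<pi> \<Longrightarrow> 1 \<le> i \<Longrightarrow> \<pi> (i + 1) j \<le> \<pi> i j"
  by (cases "shape (i + 1) j") (simp_all add: vertex_plane_partition_iff)

lemma vpp_adjacent:
  "vpp \<pi> \<Longrightarrow> 1 \<le> j \<Longrightarrow> shape i (j + 1) \<Longrightarrow> \<pi> i (j + 1) < \<pi> (i + 1) j \<or> \<pi> i (j + 1) = \<pi> i j"
  by (simp add: vertex_plane_partition_iff)

lemma vpp_row:
  assumes "vpp \<pi>" "1 \<le> c" "c \<le> c'" "shape i c'"
  shows "\<pi> i c' \<le> \<pi> i c"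
  using assms(3,4)
proof (induction c' rule: dec_induct)
  case (step c')
  have i: "1 \<le> i" using step by (simp add: in_shape_def)
  have "\<pi> i (c' + 1) \<le> \<pi> i c'"
    using vpp_adjacent[OF assms(1), of c' i] vpp_column[OF assms(1) i, of c'] step assms(2) by auto
  then show ?case using step shape_left[of i c'] assms(2) by auto
qed simp

lemma vpp_columns:
  assumes "vpp \<pi>" "1 \<le> c" "c < c'" "shape i c'"
  shows "\<pi> i c' < \<pi> (i + 1) c \<or> \<pi> i c' = \<pi> i c"
proof -
  have "c + 1 \<le> c'" using assms by simp
  then show ?thesis using assms(4)
  proof (induction c' rule: dec_induct)
    case base then show ?case using vpp_adjacent assms by blast
  next
    case (step c')
    then have sc: "shape i c'" "shape (i + 1) c'"
      using shape_left[of i c'] shape_diag[of i c'] by auto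
    have ih: "\<pi> i c' < \<pi> (i + 1) c \<or> \<pi> i c' = \<pi> i c" using step sc by blast
    have "\<pi> i (c' + 1) < \<pi> (i + 1) c' \<or> \<pi> i (c' + 1) = \<pi> i c'"
      using vpp_adjacent[OF assms(1), of c' i] step by auto
    moreover have "\<pi> (i + 1) c' \<le> \<pi> (i + 1) c"
      using vpp_row[OF assms(1), of c c' "i + 1"] sc step assms by auto
    ultimately show ?case using ih by auto
  qed
qed

definition relabel :: "(nat \<Rightarrow> nat) \<Rightarrow> (nat \<Rightarrow> nat \<Rightarrow> nat) \<Rightarrow> nat \<Rightarrow> nat \<Rightarrow> nat" where
  "relabel g \<pi> = (\<lambda>i j. if shape i j then g (\<pi> i j) else 0)"

lemma entries_relabel: "entries (relabel g \<pi>) = g ` entries \<pi>"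
  by (force simp: entries_def relabel_def)

lemma vpp_relabel:
  assumes v: "vpp \<pi>" and g: "strict_mono_on (entries \<pi>) g"
  shows "vpp (relabel g \<pi>)"
proof -
  have less: "g (\<pi> i j) < g (\<pi> i' j')" if "shape i j" "shape i' j'" "\<pi> i j < \<pi> i' j'" for i j i' j'
    using strict_mono_onD[OF g] that unfolding entries_def by blast
  have le: "g (\<pi> i j) \<le> g (\<pi> i' j')" if "shape i j" "shape i' j'" "\<pi> i j \<le> \<pi> i' j'" for i j i' j'
    using less[OF that(1,2)] that(3) by (cases "\<pi> i j = \<pi> i' j'") auto
  show ?thesis unfolding vertex_plane_partition_iff
  proof (intro conjI allI impI)
    fix i j assume "\<not> shape i j" then show "relabel g \<pi> i j = 0" by (simp add: relabel_def)
  next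
    fix i j assume "1 \<le> i \<and> shape (i + 1) j"
    then show "relabel g \<pi> (i + 1) j \<le> relabel g \<pi> i j"
      using shape_up[of i j] le vpp_column[OF v, of i j] by (auto simp: relabel_def)
  next
    fix i j assume j: "1 \<le> j \<and> shape i (j + 1)"
    then have "shape i j" "shape (i + 1) j" using shape_left shape_diag by blast+
    then show "relabel g \<pi> i (j + 1) < relabel g \<pi> (i + 1) j \<or> relabel g \<pi> i (j + 1) = relabel g \<pi> i j"
      using j less vpp_adjacent[OF v, of j i] by (auto simp: relabel_def)
  qed
qed

lemma relabel_inverse:
  assumes "vpp \<pi>" "\<And>x. x \<in> entries \<pi> \<Longrightarrow> h (g x) = x"
  shows "relabel h (relabel g \<pi>) = \<pi>"
proof (intro ext)
  fix i j show "relabel h (relabel g \<pi>) i j = \<pi> i j"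
    using assms vpp_outside[of \<pi> i j] by (auto simp: relabel_def entries_def)
qed

lemma p_count_eq: "p_count n a k = card {\<pi>. vpp \<pi> \<and> entries \<pi> = {..<k}}"
proof -
  have "entries \<pi> = {..<k} \<longleftrightarrow> (\<forall>i j. shape i j \<longrightarrow> \<pi> i j < k) \<and> (\<forall>v<k. \<exists>i j. shape i j \<and> \<pi> i j = v)"
    for \<pi> unfolding entries_def set_eq_iff mem_Collect_eq lessThan_iff by metis
  then show ?thesis unfolding p_count_def by simp
qed

lemma card_vpp_entries:
  assumes "finite S"
  shows "card {\<pi>. vpp \<pi> \<and> entries \<pi> = S} = p_count n a (card S)"
proof -
  obtain h where h: "bij_betw h {..<card S} S" "strict_mono_on {..<card S} h"
    using ex_bij_betw_strict_mono_card[OF assms] by blast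
  define g where "g = inv_into {..<card S} h"
  have gh: "g (h x) = x" if "x < card S" for x
    using h(1) that by (simp add: g_def bij_betw_def inv_into_f_f)
  have hg: "h (g y) = y" "g y < card S" if "y \<in> S" for y
    using h(1) that inv_into_into[of y h "{..<card S}"] by (auto simp: g_def bij_betw_def f_inv_into_f)
  have gmono: "strict_mono_on S g"
  proof (rule strict_mono_onI)
    fix x y assume "x \<in> S" "y \<in> S" "x < y"
    then show "g x < g y" 
      using hg strict_mono_onD[OF h(2), of "g y" "g x"] by (metis lessThan_iff linorder_neqE_nat not_less_iff_gr_or_eq)
  qed
  have him: "h ` {..<card S} = S" using h(1) by (simp add: bij_betw_def)
  have gim: "g ` S = {..<card S}" using gh hg him by force
  have "bij_betw (relabel h) {\<pi>. vpp \<pi> \<and> entries \<pi> = {..<card S}} {\<pi>. vpp \<pi> \<and> entries \<pi> = S}"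
  proof (rule bij_betw_byWitness[where f' = "relabel g"], safe)
    fix \<pi> assume "vpp \<pi>" "entries \<pi> = {..<card S}"
    then show "relabel g (relabel h \<pi>) = \<pi>" "vpp (relabel h \<pi>)"
      using h gh by (auto intro: relabel_inverse vpp_relabel)
  next
    fix \<pi> assume "vpp \<pi>" "S = entries \<pi>"
    then show "relabel h (relabel g \<pi>) = \<pi>" "vpp (relabel g \<pi>)"
      using hg gmono by (auto intro: relabel_inverse vpp_relabel)
  qed (use him gim in \<open>auto simp: entries_relabel\<close>)
  then show ?thesis unfolding p_count_eq by (simp add: bij_betw_same_card)
qed

definition cells :: "(nat \<times> nat) set" where "cells = {(i, j). shape i j}"

lemma finite_cells: "finite cells"
proof (rule finite_subset)
  show "cells \<subseteq> {..n + 1} \<times> {..n + 1}"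
    unfolding cells_def using shape_bound by fastforce
qed simp

lemma card_cells: "card cells = lam_size n a"
proof -
  have "cells = (SIGMA k:{1..n}. {1..lam n a k})" by (auto simp: cells_def in_shape_def)
  then show ?thesis by (simp add: lam_size_def)
qed

lemma entries_image: "entries \<pi> = case_prod \<pi> ` cells"
  by (force simp: entries_def cells_def)

lemma finite_entries: "finite (entries \<pi>)"
  by (simp add: entries_image finite_cells)

lemma finite_vpp_bounded: "finite {\<pi>. vpp \<pi> \<and> entries \<pi> \<subseteq> {..<k}}"
proof -
  let ?A = "{\<pi>. vpp \<pi> \<and> entries \<pi> \<subseteq> {..<k}}"
  let ?r = "\<lambda>\<pi>. restrict (case_prod \<pi>) cells"
  have "inj_on ?r ?A"
  proof (rule inj_onI)
    fix p q assume p: "p \<in> ?A" and q: "q \<in> ?A" and eq: "?r p = ?r q"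
    show "p = q"
    proof (intro ext)
      fix i j show "p i j = q i j"
        using p q fun_cong[OF eq, of "(i, j)"] vpp_outside[of p i j] vpp_outside[of q i j]
        by (cases "shape i j") (auto simp: cells_def)
    qed
  qed
  moreover have "?r ` ?A \<subseteq> cells \<rightarrow>\<^sub>E {..<k}" by (auto simp: entries_image)
  then have "finite (?r ` ?A)" by (rule finite_subset) (simp add: finite_PiE finite_cells)
  ultimately show ?thesis using finite_imageD by blast
qed

lemma p_count_zero: "lam_size n a < k \<Longrightarrow> p_count n a k = 0"
proof -
  assume k: "lam_size n a < k"
  have "entries \<pi> \<noteq> {..<k}" for \<pi>
  proof
    assume "entries \<pi> = {..<k}"
    then have "k \<le> card cells" using card_image_le[OF finite_cells, of "case_prod \<pi>"]
      by (simp add: entries_image[symmetric])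
    then show False using k by (simp add: card_cells)
  qed
  then show ?thesis by (simp add: p_count_eq)
qed

lemma card_vpp_bounded:
  "card {\<pi>. vpp \<pi> \<and> entries \<pi> \<subseteq> {..<M}} = (\<Sum>k\<le>lam_size n a. (M choose k) * p_count n a k)"
proof -
  have "{\<pi>. vpp \<pi> \<and> entries \<pi> \<subseteq> {..<M}} = (\<Union>S\<in>Pow {..<M}. {\<pi>. vpp \<pi> \<and> entries \<pi> = S})" by auto
  also have "card \<dots> = (\<Sum>S\<in>Pow {..<M}. card {\<pi>. vpp \<pi> \<and> entries \<pi> = S})"
    by (rule card_UN_disjoint) (auto intro: finite_subset[OF _ finite_vpp_bounded[of M]])
  also have "\<dots> = (\<Sum>S\<in>Pow {..<M}. p_count n a (card S))"
    by (intro sum.cong refl card_vpp_entries) (auto intro: finite_subset)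
  also have "\<dots> = (\<Sum>k\<le>M. \<Sum>S\<in>{S\<in>Pow {..<M}. card S = k}. p_count n a (card S))"
    by (rule sum.group[symmetric]) (auto intro: order.trans[OF card_mono[of "{..<M}"]])
  also have "\<dots> = (\<Sum>k\<le>M. (M choose k) * p_count n a k)"
  proof (intro sum.cong refl)
    fix k
    have "card {S\<in>Pow {..<M}. card S = k} = M choose k"
      using n_subsets[of "{..<M}" k] by simp
    then show "(\<Sum>S\<in>{S\<in>Pow {..<M}. card S = k}. p_count n a (card S)) = (M choose k) * p_count n a k"
      by simp
  qed
  also have "\<dots> = (\<Sum>k\<le>max M (lam_size n a). (M choose k) * p_count n a k)"
    by (rule sum.mono_neutral_left) auto
  also have "\<dots> = (\<Sum>k\<le>lam_size n a. (M choose k) * p_count n a k)"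
    by (rule sum.mono_neutral_right) (auto simp: p_count_zero)
  finally show ?thesis .
qed

text \<open>Filling the columns from right to left, each from bottom to top, gives distinct entries.\<close>
lemma p_count_lam_size_pos: "p_count n a (lam_size n a) > 0"
proof -
  define \<pi> where "\<pi> = (\<lambda>i j. if shape i j then (n - j) * (n + 1) + (n - i) else 0)"
  have v: "vpp \<pi>" unfolding vertex_plane_partition_iff
  proof (intro conjI allI impI)
    fix i j assume "\<not> shape i j" then show "\<pi> i j = 0" by (simp add: \<pi>_def)
  next
    fix i j assume "1 \<le> i \<and> shape (i + 1) j"
    then show "\<pi> (i + 1) j \<le> \<pi> i j" using shape_up[of i j] by (simp add: \<pi>_def)
  next
    fix i j assume j: "1 \<le> j \<and> shape i (j + 1)"
    then have s: "shape (i + 1) j" using shape_diag by blast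
    have b: "1 \<le> i" "i + 1 \<le> n" "j + 1 \<le> n"
      using s j shape_bound[of i "j + 1"] by (auto simp: in_shape_def)
    then have "n - j = Suc (n - (j + 1))" by simp
    then have "\<pi> i (j + 1) < \<pi> (i + 1) j" using j s b by (simp add: \<pi>_def)
    then show "\<pi> i (j + 1) < \<pi> (i + 1) j \<or> \<pi> i (j + 1) = \<pi> i j" ..
  qed
  have inj: "inj_on (case_prod \<pi>) cells"
  proof (rule inj_onI, clarify)
    fix i j i' j' assume c: "(i, j) \<in> cells" "(i', j') \<in> cells" "\<pi> i j = \<pi> i' j'"
    then have s: "shape i j" "shape i' j'" by (auto simp: cells_def)
    then have b: "1 \<le> i" "i \<le> n" "1 \<le> i'" "i' \<le> n" "j \<le> n" "j' \<le> n"
      using shape_bound[of i j] shape_bound[of i' j'] by (auto simp: in_shape_def)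
    have eq: "(n - i) + (n + 1) * (n - j) = (n - i') + (n + 1) * (n - j')"
      using c(3) s by (simp add: \<pi>_def algebra_simps)
    have "((n - i) + (n + 1) * (n - j)) div (n + 1) = n - j"
         "((n - i') + (n + 1) * (n - j')) div (n + 1) = n - j'"
      by (simp_all only: div_mult_self2) (auto)
    then have "n - j = n - j'" using eq by simp
    then show "i = i' \<and> j = j'" using eq b by auto
  qed
  have "card (entries \<pi>) = lam_size n a"
    using card_image[OF inj] by (simp add: entries_image card_cells)
  moreover have "card {\<pi>'. vpp \<pi>' \<and> entries \<pi>' = entries \<pi>} > 0"
  proof -
    obtain k where "entries \<pi> \<subseteq> {..<k}" using finite_nat_iff_bounded finite_entries by blast
    then have "finite {\<pi>'. vpp \<pi>' \<and> entries \<pi>' = entries \<pi>}"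
      by (intro finite_subset[OF _ finite_vpp_bounded[of k]]) auto
    then show ?thesis using v card_gt_0_iff by blast
  qed
  ultimately show ?thesis using card_vpp_entries[OF finite_entries, of \<pi>] by simp
qed

subsection \<open>Lattice paths\<close>

definition right_edge :: "nat \<Rightarrow> nat \<Rightarrow> gedge" where
  "right_edge r j = (Some (r, j), Some (r, j + 1))"

definition down_edge :: "nat \<Rightarrow> nat \<Rightarrow> gedge" where
  "down_edge r j = (Some (r, j), if r < n then Some (r + 1, j) else None)"

lemma right_edge_in: "right_edge r j \<in> G_edges n m \<longleftrightarrow> 1 \<le> r \<and> r \<le> n \<and> j < m"
  by (auto simp: right_edge_def G_edges_def)

lemma down_edge_in: "down_edge r j \<in> G_edges n m \<longleftrightarrow> 1 \<le> r \<and> r \<le> n \<and> j \<le> m"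
  using n_pos by (auto simp: down_edge_def G_edges_def)

lemma edge_cases:
  assumes "e \<in> G_edges n m"
  obtains r j where "1 \<le> r" "r \<le> n" "j < m" "e = right_edge r j"
  | r j where "1 \<le> r" "r \<le> n" "j \<le> m" "e = down_edge r j"
  using assms n_pos unfolding G_edges_def right_edge_def down_edge_def by fastforce

lemma right_neq_down: "right_edge r j \<noteq> down_edge r' j'"
  by (auto simp: right_edge_def down_edge_def)

lemma right_eq_iff: "right_edge r j = right_edge r' j' \<longleftrightarrow> r = r' \<and> j = j'"
  by (auto simp: right_edge_def)

lemma down_eq_iff: "down_edge r j = down_edge r' j' \<longleftrightarrow> r = r' \<and> j = j'"
  by (auto simp: down_edge_def)

lemma finite_G_edges: "finite (G_edges n m)"
proof (rule finite_subset)
  show "G_edges n m \<subseteq> (\<lambda>(r, j). right_edge r j) ` ({..n} \<times> {..m}) \<union> (\<lambda>(r, j). down_edge r j) ` ({..n} \<times> {..m})"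
  proof
    fix e assume "e \<in> G_edges n m"
    then show "e \<in> (\<lambda>(r, j). right_edge r j) ` ({..n} \<times> {..m}) \<union> (\<lambda>(r, j). down_edge r j) ` ({..n} \<times> {..m})"
      by (cases rule: edge_cases) force+
  qed
qed simp

definition pot :: "nat \<Rightarrow> gvert \<Rightarrow> nat" where
  "pot m v = (case v of None \<Rightarrow> n + m + 1 | Some (i, j) \<Rightarrow> i + j)"

sublocale dag_network "G_edges n m" "G_verts n m" "demand n a" None "pot m" "n + m + 1" for m
proof
  fix e assume "e \<in> G_edges n m"
  then show "fst e \<in> G_verts n m \<and> snd e \<in> G_verts n m" "pot m (fst e) < pot m (snd e)"
    by (cases rule: edge_cases; auto simp: right_edge_def down_edge_def G_verts_def pot_def)+
qed (auto simp: finite_G_edges G_verts_def pot_def demand_def split: option.splits)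

lemma flow_polytope_eq: "flow_polytope n m a = flows (G_edges n m) (G_verts n m) (demand n a)"
  by (simp add: flow_polytope_def flows_def netflow_def)

text \<open>For \<open>r = 1\<close> the last term is evaluated at a non-edge and vanishes.\<close>
lemma netflow_inner:
  assumes x: "\<And>e. e \<notin> G_edges n m \<Longrightarrow> x e = 0" and r: "1 \<le> r" "r \<le> n"
  shows "netflow (G_edges n m) x (Some (r, j)) =
    x (right_edge r j) + x (down_edge r j) -
      ((if j = 0 then 0 else x (right_edge r (j - 1))) + x (down_edge (r - 1) j))"
proof -
  let ?E = "G_edges n m"
  have out: "(\<Sum>e\<in>{e\<in>?E. fst e = Some (r, j)}. x e) = (\<Sum>e\<in>{right_edge r j, down_edge r j}. x e)"
  proof (rule sum.mono_neutral_left)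
    show "{e\<in>?E. fst e = Some (r, j)} \<subseteq> {right_edge r j, down_edge r j}"
      by (auto elim!: edge_cases simp: right_edge_def down_edge_def)
    show "\<forall>e\<in>{right_edge r j, down_edge r j} - {e\<in>?E. fst e = Some (r, j)}. x e = 0"
      using x by (auto simp: right_edge_def down_edge_def)
  qed simp
  have inn: "(\<Sum>e\<in>{e\<in>?E. snd e = Some (r, j)}. x e) =
      (\<Sum>e\<in>(if j = 0 then {} else {right_edge r (j - 1)}) \<union> {down_edge (r - 1) j}. x e)"
  proof (rule sum.mono_neutral_left)
    show "{e\<in>?E. snd e = Some (r, j)} \<subseteq> (if j = 0 then {} else {right_edge r (j - 1)}) \<union> {down_edge (r - 1) j}"
      by (auto elim!: edge_cases simp: right_edge_def down_edge_def split: if_splits)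
    show "\<forall>e\<in>(if j = 0 then {} else {right_edge r (j - 1)}) \<union> {down_edge (r - 1) j} - {e\<in>?E. snd e = Some (r, j)}. x e = 0"
      using x r by (auto simp: right_edge_def down_edge_def)
  qed simp
  show ?thesis unfolding netflow_def out inn
    by (auto simp: right_neq_down right_neq_down[symmetric])
qed

lemma netflow_sink: "netflow (G_edges n m) x None = - (\<Sum>j\<le>m. x (down_edge n j))"
proof -
  have "(\<Sum>e\<in>{e\<in>G_edges n m. fst e = None}. x e) = 0"
    by (rule sum.neutral) (auto elim!: edge_cases simp: right_edge_def down_edge_def)
  moreover have "{e\<in>G_edges n m. snd e = None} = down_edge n ` {..m}"
  proof
    show "{e\<in>G_edges n m. snd e = None} \<subseteq> down_edge n ` {..m}"
      by (auto elim!: edge_cases simp: right_edge_def down_edge_def split: if_splits)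
    show "down_edge n ` {..m} \<subseteq> {e\<in>G_edges n m. snd e = None}"
      using n_pos by (auto simp: down_edge_in) (simp add: down_edge_def)
  qed
  moreover have "inj_on (down_edge n) {..m}" by (auto simp: inj_on_def down_eq_iff)
  ultimately show ?thesis unfolding netflow_def by (simp only: sum.reindex) simp
qed

text \<open>Column \<open>c\<close> of \<open>\<pi>\<close> encodes the lattice path which leaves row \<open>r\<close> of the grid at column
  \<open>\<pi> (n + 1 - r) c\<close>; the row in which it starts is the first one with \<open>shape (n + 1 - r) c\<close>, and it
  starts at column 0, which is the value of \<open>\<pi>\<close> just outside the shape.\<close>
definition path_flow :: "(nat \<Rightarrow> nat \<Rightarrow> nat) \<Rightarrow> nat \<Rightarrow> gedge \<Rightarrow> real" where
  "path_flow \<pi> c e = of_bool (\<exists>r j. shape (n + 1 - r) c \<and>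
     (e = right_edge r j \<and> \<pi> (n + 1 - r + 1) c \<le> j \<and> j < \<pi> (n + 1 - r) c \<or>
      e = down_edge r j \<and> \<pi> (n + 1 - r) c = j))"

definition flow_of :: "(nat \<Rightarrow> nat \<Rightarrow> nat) \<Rightarrow> gedge \<Rightarrow> real" where
  "flow_of \<pi> e = (\<Sum>c=1..n. path_flow \<pi> c e)"

lemma path_flow_right:
  "path_flow \<pi> c (right_edge r j) =
     of_bool (shape (n + 1 - r) c \<and> \<pi> (n + 1 - r + 1) c \<le> j \<and> j < \<pi> (n + 1 - r) c)"
  unfolding path_flow_def right_eq_iff by (auto simp: right_neq_down)

lemma path_flow_down:
  "path_flow \<pi> c (down_edge r j) = of_bool (shape (n + 1 - r) c \<and> \<pi> (n + 1 - r) c = j)"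
  unfolding path_flow_def down_eq_iff by (auto simp: right_neq_down[symmetric])

lemma shape_column_bound: "shape k c \<Longrightarrow> 1 \<le> c \<and> c \<le> n"
  using shape_bound[of k c] by (auto simp: in_shape_def)

lemma flow_of_pos: "flow_of \<pi> e > 0 \<longleftrightarrow> (\<exists>c. path_flow \<pi> c e \<noteq> 0)"
proof -
  have nn: "\<And>c. path_flow \<pi> c e \<ge> 0" by (simp add: path_flow_def)
  have "flow_of \<pi> e \<ge> 0" using nn by (simp add: flow_of_def sum_nonneg)
  moreover have "flow_of \<pi> e = 0 \<longleftrightarrow> (\<forall>c\<in>{1..n}. path_flow \<pi> c e = 0)"
    unfolding flow_of_def by (rule sum_nonneg_eq_0_iff) (use nn in auto)
  moreover have "path_flow \<pi> c e = 0" if "c \<notin> {1..n}" for c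
    using that shape_column_bound unfolding path_flow_def by auto
  ultimately show ?thesis by (metis less_le)
qed

lemma flow_of_right_pos:
  "flow_of \<pi> (right_edge r j) > 0 \<longleftrightarrow>
     (\<exists>c. shape (n + 1 - r) c \<and> \<pi> (n + 1 - r + 1) c \<le> j \<and> j < \<pi> (n + 1 - r) c)"
  by (auto simp: flow_of_pos path_flow_right)

lemma flow_of_down_pos:
  "flow_of \<pi> (down_edge r j) > 0 \<longleftrightarrow> (\<exists>c. shape (n + 1 - r) c \<and> \<pi> (n + 1 - r) c = j)"
  by (auto simp: flow_of_pos path_flow_down)

lemma path_flow_off_edges:
  assumes le: "\<And>i j. \<pi> i j \<le> m" and e: "e \<notin> G_edges n m"
  shows "path_flow \<pi> c e = 0"
proof (rule ccontr)
  assume "path_flow \<pi> c e \<noteq> 0"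
  then obtain r j where rj: "shape (n + 1 - r) c"
     "e = right_edge r j \<and> j < \<pi> (n + 1 - r) c \<or> e = down_edge r j \<and> \<pi> (n + 1 - r) c = j"
    by (auto simp: path_flow_def)
  have "1 \<le> r" "r \<le> n" using rj(1) by (auto simp: in_shape_def)
  then show False using rj(2) e le[of "n + 1 - r" c] by (auto simp: right_edge_in down_edge_in)
qed

lemma netflow_path_inner:
  assumes v: "vpp \<pi>" and le: "\<And>i j. \<pi> i j \<le> m" and r: "1 \<le> r" "r \<le> n"
  shows "netflow (G_edges n m) (path_flow \<pi> c) (Some (r, j)) =
    of_bool (j = 0 \<and> shape (n + 1 - r) c \<and> \<not> shape (n + 1 - r + 1) c)"
proof -
  define k where "k = n + 1 - r"
  have k: "1 \<le> k" "n + 1 - (r - 1) = k + 1" using r by (auto simp: k_def)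
  have mono: "\<pi> (k + 1) c \<le> \<pi> k c" using vpp_column[OF v k(1)] .
  have up: "shape (k + 1) c \<Longrightarrow> shape k c" using shape_up k(1) by blast
  have out: "\<not> shape (k + 1) c \<Longrightarrow> \<pi> (k + 1) c = 0" using vpp_outside[OF v] .
  have off: "path_flow \<pi> c e = 0" if "e \<notin> G_edges n m" for e
    using path_flow_off_edges[OF le that] .
  have "netflow (G_edges n m) (path_flow \<pi> c) (Some (r, j)) =
      path_flow \<pi> c (right_edge r j) + path_flow \<pi> c (down_edge r j) -
        ((if j = 0 then 0 else path_flow \<pi> c (right_edge r (j - 1))) + path_flow \<pi> c (down_edge (r - 1) j))"
    by (rule netflow_inner[OF _ r]) (rule off)
  then show ?thesis
    unfolding path_flow_right path_flow_down k(2) k_def[symmetric]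
    using mono up out by (cases "shape (k + 1) c"; cases "shape k c"; cases j) (auto simp: of_bool_def)
qed

lemma sum_shape_row: "1 \<le> k \<Longrightarrow> k \<le> n \<Longrightarrow> (\<Sum>c=1..n. of_bool (shape k c)) = real (lam n a k)"
proof -
  assume k: "1 \<le> k" "k \<le> n"
  have "{1..n} \<inter> {c. shape k c} = {1..lam n a k}"
    using shape_column_bound[of k] k by (auto simp: in_shape_def)
  then show ?thesis by (simp add: sum_of_bool_eq)
qed

lemma sum_shape_start:
  assumes r: "1 \<le> r" "r \<le> n"
  shows "(\<Sum>c=1..n. of_bool (shape (n + 1 - r) c \<and> \<not> shape (n + 1 - r + 1) c)) = real (a r)"
proof -
  define k where "k = n + 1 - r"
  have k: "1 \<le> k" "k \<le> n" "n + 1 - k = r" using r by (auto simp: k_def)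
  have "{1..n} \<inter> {c. shape k c \<and> \<not> shape (k + 1) c} = {lam n a (k + 1)<..lam n a k}"
    using shape_column_bound[of k] k by (auto simp: in_shape_def lam_def)
  moreover have "card {lam n a (k + 1)<..lam n a k} = a r" using lam_step[OF k(1,2)] k(3) by simp
  ultimately show ?thesis unfolding k_def[symmetric] 
    by (simp add: sum_of_bool_eq)
qed

lemma flow_of_in_flows:
  assumes v: "vpp \<pi>" and le: "\<And>i j. \<pi> i j \<le> m"
  shows "flow_of \<pi> \<in> flows (G_edges n m) (G_verts n m) (demand n a)"
proof -
  have eq: "flow_of \<pi> = (\<lambda>e. \<Sum>c=1..n. path_flow \<pi> c e)" by (simp add: flow_of_def fun_eq_iff)
  have "flow_of \<pi> e = 0" if "e \<notin> G_edges n m" for e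
    using path_flow_off_edges[OF le that] by (simp add: flow_of_def)
  moreover have "0 \<le> flow_of \<pi> e" for e by (auto simp: flow_of_def path_flow_def intro: sum_nonneg)
  moreover have "netflow (G_edges n m) (flow_of \<pi>) u = demand n a u" if u: "u \<in> G_verts n m" for u
  proof (cases u)
    case None
    have "(\<Sum>j\<le>m. path_flow \<pi> c (down_edge n j)) = of_bool (shape 1 c)" for c
      using le[of 1 c] by (auto simp: path_flow_down of_bool_def sum.delta' cong: if_cong)
    then have "netflow (G_edges n m) (flow_of \<pi>) None = - real (lam n a 1)"
      unfolding eq netflow_sum netflow_sink using sum_shape_row[of 1] n_pos by (simp add: sum_negf)
    then show ?thesis using None n_pos by (simp add: demand_def lam_def)
  next
    case (Some p)
    then obtain r j where p: "u = Some (r, j)" "1 \<le> r" "r \<le> n" using u by (auto simp: G_verts_def)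
    have "netflow (G_edges n m) (flow_of \<pi>) u =
        (\<Sum>c=1..n. of_bool (j = 0 \<and> shape (n + 1 - r) c \<and> \<not> shape (n + 1 - r + 1) c))"
      unfolding eq netflow_sum p(1) netflow_path_inner[OF v le p(2,3)] ..
    then show ?thesis using sum_shape_start[OF p(2,3)] p(1) by (cases "j = 0") (auto simp: demand_def)
  qed
  ultimately show ?thesis by (simp add: flows_def)
qed

lemma confluent_iff:
  "confluent (G_edges n m) x \<longleftrightarrow>
     (\<forall>r j. 1 \<le> r \<and> r \<le> n \<and> j < m \<longrightarrow> \<not> (x (right_edge r j) > 0 \<and> x (down_edge r j) > 0))"
  (is "?L \<longleftrightarrow> ?R")
proof
  assume L: ?L
  show ?R
  proof (intro allI impI)
    fix r j assume "1 \<le> r \<and> r \<le> n \<and> j < m"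
    then have "right_edge r j \<in> G_edges n m" "down_edge r j \<in> G_edges n m"
      by (auto simp: right_edge_in down_edge_in)
    moreover have "fst (right_edge r j) = fst (down_edge r j)" by (simp add: right_edge_def down_edge_def)
    ultimately show "\<not> (x (right_edge r j) > 0 \<and> x (down_edge r j) > 0)"
      using L right_neq_down unfolding confluent_def by blast
  qed
next
  assume R: ?R
  have f: "fst (right_edge r j) = Some (r, j)" "fst (down_edge r j) = Some (r, j)" for r j
    by (simp_all add: right_edge_def down_edge_def)
  show ?L unfolding confluent_def
  proof (intro ballI impI)
    fix e e' assume e: "e \<in> G_edges n m" "e' \<in> G_edges n m" "fst e = fst e' \<and> x e > 0 \<and> x e' > 0"
    from e(1) show "e = e'"
    proof (cases rule: edge_cases)
      case (1 r j)
      from e(2) show ?thesis by (cases rule: edge_cases) (use 1 e(3) R in \<open>auto simp: f\<close>)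
    next
      case (2 r j)
      from e(2) show ?thesis by (cases rule: edge_cases) (use 2 e(3) R in \<open>auto simp: f\<close>)
    qed
  qed
qed

lemma confluent_flow_of:
  assumes v: "vpp \<pi>"
  shows "confluent (G_edges n m) (flow_of \<pi>)"
  unfolding confluent_iff
proof (intro allI impI notI)
  fix r j assume r: "1 \<le> r \<and> r \<le> n \<and> j < m"
    and pos: "0 < flow_of \<pi> (right_edge r j) \<and> 0 < flow_of \<pi> (down_edge r j)"
  define k where "k = n + 1 - r"
  obtain c where c: "shape k c" "\<pi> (k + 1) c \<le> j" "j < \<pi> k c"
    using pos unfolding flow_of_right_pos k_def by blast
  obtain d where d: "shape k d" "\<pi> k d = j"
    using pos unfolding flow_of_down_pos k_def by blast
  have "1 \<le> c" "1 \<le> d" using c d by (auto simp: in_shape_def)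
  consider "c = d" | "c < d" | "d < c" by linarith
  then show False
  proof cases
    case 2 then show ?thesis using vpp_columns[OF v \<open>1 \<le> c\<close> 2 d(1)] c d by auto
  next
    case 3 then show ?thesis using vpp_row[OF v \<open>1 \<le> d\<close> _ c(1)] c d by auto
  qed (use c d in auto)
qed

definition exit_column :: "(gedge \<Rightarrow> real) \<Rightarrow> nat \<Rightarrow> nat \<Rightarrow> nat" where
  "exit_column x r e = (LEAST j. e \<le> j \<and> x (down_edge r j) > 0)"

lemma vpp_eq_exit_column:
  assumes v: "vpp \<pi>" and s: "shape k c"
  shows "\<pi> k c = exit_column (flow_of \<pi>) (n + 1 - k) (\<pi> (k + 1) c)"
proof -
  have k: "1 \<le> k" "n + 1 - (n + 1 - k) = k" "1 \<le> c" using s by (auto simp: in_shape_def)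
  show ?thesis unfolding exit_column_def
  proof (rule Least_equality[symmetric])
    show "\<pi> (k + 1) c \<le> \<pi> k c \<and> 0 < flow_of \<pi> (down_edge (n + 1 - k) (\<pi> k c))"
      using vpp_column[OF v k(1)] s unfolding flow_of_down_pos k by auto
    fix j assume j: "\<pi> (k + 1) c \<le> j \<and> 0 < flow_of \<pi> (down_edge (n + 1 - k) j)"
    then obtain d where d: "shape k d" "\<pi> k d = j" unfolding flow_of_down_pos k by blast
    then have "1 \<le> d" by (auto simp: in_shape_def)
    show "\<pi> k c \<le> j"
    proof (cases "c < d")
      case True then show ?thesis using vpp_columns[OF v k(3) True d(1)] d j by auto
    next
      case False then show ?thesis using vpp_row[OF v \<open>1 \<le> d\<close> _ s] d by auto
    qed
  qed
qed

lemma flow_of_inj: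
  assumes v: "vpp \<pi>" "vpp \<pi>'" and eq: "flow_of \<pi> = flow_of \<pi>'"
  shows "\<pi> = \<pi>'"
proof (intro ext)
  fix k c show "\<pi> k c = \<pi>' k c"
  proof (induction "n + 1 - k" arbitrary: k rule: less_induct)
    case less
    show ?case
    proof (cases "shape k c")
      case True
      then have "n + 1 - (k + 1) < n + 1 - k" by (auto simp: in_shape_def)
      from less.hyps[OF this] show ?thesis
        using vpp_eq_exit_column[OF v(1) True] vpp_eq_exit_column[OF v(2) True] eq by simp
    next
      case False then show ?thesis using vpp_outside[OF v(1)] vpp_outside[OF v(2)] by simp
    qed
  qed
qed

subsection \<open>Reading off the paths of a confluent flow\<close>

primrec trace_path :: "(gedge \<Rightarrow> real) \<Rightarrow> nat \<Rightarrow> nat \<Rightarrow> nat" where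
  "trace_path x c 0 = 0"
| "trace_path x c (Suc r) =
     (if shape (n - r) c then exit_column x (Suc r) (trace_path x c r) else 0)"

definition trace :: "(gedge \<Rightarrow> real) \<Rightarrow> nat \<Rightarrow> nat \<Rightarrow> nat" where
  "trace x k c = trace_path x c (n + 1 - k)"

lemma trace_outside: "\<not> shape k c \<Longrightarrow> trace x k c = 0"
proof -
  assume s: "\<not> shape k c"
  show ?thesis
  proof (cases "n + 1 - k")
    case (Suc r)
    then have "n - r = k \<or> n - r = 0" by auto
    then have "\<not> shape (n - r) c" using s by (auto simp: in_shape_def)
    then show ?thesis using Suc by (simp add: trace_def)
  qed (simp add: trace_def)
qed

lemma trace_inside: 
  assumes "shape k c"
  shows "trace x k c = exit_column x (n + 1 - k) (trace x (k + 1) c)"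
proof -
  have "1 \<le> k" "k \<le> n" using assms by (auto simp: in_shape_def)
  then have "n + 1 - k = Suc (n - k)" "n - (n - k) = k" "n + 1 - (k + 1) = n - k" by auto
  then show ?thesis using assms by (simp add: trace_def)
qed

context
  fixes m :: nat and x :: "gedge \<Rightarrow> real"
  assumes x_flow: "x \<in> flows (G_edges n m) (G_verts n m) (demand n a)"
    and x_confluent: "confluent (G_edges n m) x"
begin

definition active :: "nat \<Rightarrow> nat \<Rightarrow> bool" where
  "active r j \<longleftrightarrow> 1 \<le> r \<and> r \<le> n \<and> j \<le> m \<and> x (right_edge r j) + x (down_edge r j) > 0"

lemma x_off: "e \<notin> G_edges n m \<Longrightarrow> x e = 0"
  using x_flow unfolding flows_def by blast

lemma x_nonneg: "0 \<le> x e"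
  using x_flow x_off[of e] unfolding flows_def by (cases "e \<in> G_edges n m") auto

lemma outflow_eq:
  assumes "1 \<le> r" "r \<le> n" "j \<le> m"
  shows "x (right_edge r j) + x (down_edge r j) =
    (if j = 0 then real (a r) else x (right_edge r (j - 1))) + x (down_edge (r - 1) j)"
proof -
  have "Some (r, j) \<in> G_verts n m" using assms by (simp add: G_verts_def)
  then have "netflow (G_edges n m) x (Some (r, j)) = demand n a (Some (r, j))"
    using x_flow unfolding flows_def by blast
  moreover have "netflow (G_edges n m) x (Some (r, j)) =
    x (right_edge r j) + x (down_edge r j) -
      ((if j = 0 then 0 else x (right_edge r (j - 1))) + x (down_edge (r - 1) j))"
    by (rule netflow_inner[OF _ assms(1,2)]) (rule x_off)
  ultimately show ?thesis by (auto simp: demand_def split: if_splits)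
qed

lemma active_exit:
  assumes "active r e"
  shows "\<exists>j\<ge>e. j \<le> m \<and> x (down_edge r j) > 0 \<and>
     (\<forall>t. e \<le> t \<and> t < j \<longrightarrow> x (right_edge r t) > 0 \<and> \<not> x (down_edge r t) > 0)"
  using assms
proof (induction "m - e" arbitrary: e rule: less_induct)
  case less
  have r: "1 \<le> r" "r \<le> n" "e \<le> m" using less.prems by (auto simp: active_def)
  show ?case
  proof (cases "x (down_edge r e) > 0")
    case True then show ?thesis using r by (intro exI[of _ e]) auto
  next
    case False
    then have pos: "x (right_edge r e) > 0"
      using less.prems x_nonneg[of "down_edge r e"] by (auto simp: active_def)
    then have "right_edge r e \<in> G_edges n m" using x_off[of "right_edge r e"] by fastforce
    then have e: "e < m" by (simp add: right_edge_in)
    have "active r (e + 1)"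
      using outflow_eq[OF r(1,2), of "e + 1"] pos x_nonneg[of "down_edge (r - 1) (e + 1)"] e r
      by (simp add: active_def)
    moreover have "m - (e + 1) < m - e" using e by simp
    ultimately obtain j where j: "j \<ge> e + 1" "j \<le> m" "x (down_edge r j) > 0"
      "\<forall>t. e + 1 \<le> t \<and> t < j \<longrightarrow> x (right_edge r t) > 0 \<and> \<not> x (down_edge r t) > 0"
      using less.hyps by blast
    have "x (right_edge r t) > 0 \<and> \<not> x (down_edge r t) > 0" if "e \<le> t" "t < j" for t
      using j(4) pos False that by (cases "t = e") auto
    then show ?thesis using j by (intro exI[of _ j]) auto
  qed
qed

lemma exit_column_props:
  assumes "active r e"
  shows "e \<le> exit_column x r e" "exit_column x r e \<le> m" "x (down_edge r (exit_column x r e)) > 0"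
    "\<And>t. e \<le> t \<Longrightarrow> t < exit_column x r e \<Longrightarrow> x (right_edge r t) > 0"
proof -
  obtain j where j: "j \<ge> e" "j \<le> m" "x (down_edge r j) > 0"
     "\<forall>t. e \<le> t \<and> t < j \<longrightarrow> x (right_edge r t) > 0 \<and> \<not> x (down_edge r t) > 0"
    using active_exit[OF assms] by blast
  have "exit_column x r e = j" unfolding exit_column_def
  proof (rule Least_equality)
    fix y assume "e \<le> y \<and> 0 < x (down_edge r y)"
    then show "j \<le> y" using j(4) by (meson not_le_imp_less)
  qed (use j in auto)
  then show "e \<le> exit_column x r e" "exit_column x r e \<le> m" "x (down_edge r (exit_column x r e)) > 0"
    "\<And>t. e \<le> t \<Longrightarrow> t < exit_column x r e \<Longrightarrow> x (right_edge r t) > 0"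
    using j by auto
qed

lemma exit_column_le: "e \<le> j \<Longrightarrow> x (down_edge r j) > 0 \<Longrightarrow> exit_column x r e \<le> j"
  unfolding exit_column_def by (rule Least_le) simp

lemma trace_active: "shape k c \<Longrightarrow> active (n + 1 - k) (trace x (k + 1) c)"
proof (induction "n + 1 - k" arbitrary: k rule: less_induct)
  case less
  have k: "1 \<le> k" "k \<le> n" using less.prems by (auto simp: in_shape_def)
  define r where "r = n + 1 - k"
  have r: "1 \<le> r" "r \<le> n" "n + 1 - (k + 1) = r - 1" "n + 1 - k = r" using k by (auto simp: r_def)
  show ?case
  proof (cases "shape (k + 1) c")
    case True
    have "active (r - 1) (trace x (k + 1 + 1) c)" using less.hyps[OF _ True] r by simp
    note props = exit_column_props[OF this]
    have eq: "trace x (k + 1) c = exit_column x (r - 1) (trace x (k + 1 + 1) c)"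
      using trace_inside[OF True] r by simp
    have pos: "x (down_edge (r - 1) (trace x (k + 1) c)) > 0" "trace x (k + 1) c \<le> m"
      using props(2,3) unfolding eq by auto
    show ?thesis
      using outflow_eq[OF r(1,2) pos(2)] pos r x_nonneg[of "right_edge r (trace x (k + 1) c - 1)"]
      unfolding active_def r(4) by (auto split: if_splits intro: add_nonneg_pos)
  next
    case False
    then have 0: "trace x (k + 1) c = 0" by (rule trace_outside)
    have "lam n a (k + 1) < lam n a k"
      using less.prems False by (auto simp: in_shape_def lam_def)
    then have "a r > 0" using lam_step[OF k] by (simp add: r_def)
    then show ?thesis
      using outflow_eq[OF r(1,2), of 0] r x_nonneg[of "down_edge (r - 1) 0"]
      unfolding active_def 0 r(4) by (auto intro: add_pos_nonneg)
  qed
qed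

lemma trace_le: "trace x k c \<le> m"
proof (cases "shape k c")
  case True
  then show ?thesis using exit_column_props(2)[OF trace_active[OF True]] trace_inside[OF True] by simp
qed (simp add: trace_outside)

lemma trace_column: "shape k c \<Longrightarrow> trace x (k + 1) c \<le> trace x k c"
  using exit_column_props(1)[OF trace_active, of k c] trace_inside[of k c x] by simp

lemma trace_adjacent:
  assumes "1 \<le> c" "shape k (c + 1)"
  shows "trace x k (c + 1) \<le> trace x k c \<and>
    (trace x k (c + 1) < trace x (k + 1) c \<or> trace x k (c + 1) = trace x k c)"
  using assms(2)
proof (induction "n + 1 - k" arbitrary: k rule: less_induct)
  case less
  define e where "e = trace x (k + 1) c"
  define e' where "e' = trace x (k + 1) (c + 1)"
  let ?X = "exit_column x (n + 1 - k)"
  have s: "shape k c" using shape_left less.prems assms(1) by blast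
  have k: "1 \<le> k" "k \<le> n" using s by (auto simp: in_shape_def)
  have "e' \<le> e"
  proof (cases "shape (k + 1) (c + 1)")
    case True then show ?thesis using less.hyps[of "k + 1"] k by (simp add: e_def e'_def)
  next
    case False then show ?thesis by (simp add: e'_def trace_outside)
  qed
  have eq: "trace x k c = ?X e" "trace x k (c + 1) = ?X e'"
    using trace_inside[OF s] trace_inside[OF less.prems] by (simp_all add: e_def e'_def)
  note p = exit_column_props[OF trace_active[OF s], folded e_def]
  note p' = exit_column_props[OF trace_active[OF less.prems], folded e'_def]
  show ?case
  proof (cases "?X e' < e")
    case True then show ?thesis using p(1) unfolding eq e_def[symmetric] by simp
  next
    case False
    then have "?X e \<le> ?X e'" using p'(3) by (intro exit_column_le) auto
    moreover have "?X e' \<le> ?X e" using p(1,3) \<open>e' \<le> e\<close> by (intro exit_column_le) auto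
    ultimately show ?thesis unfolding eq by simp
  qed
qed

lemma trace_vpp: "vpp (trace x)"
  unfolding vertex_plane_partition_iff
  using trace_outside trace_column shape_up trace_adjacent by blast

lemma flow_of_trace: "flow_of (trace x) = x"
proof (rule confluent_support_unique[OF x_confluent flow_of_in_flows[OF trace_vpp trace_le] x_flow])
  fix e assume "flow_of (trace x) e \<noteq> 0"
  then obtain c where "path_flow (trace x) c e \<noteq> 0"
    unfolding flow_of_def by (metis sum.neutral)
  then obtain r j where rj: "shape (n + 1 - r) c"
     "e = right_edge r j \<and> trace x (n + 1 - r + 1) c \<le> j \<and> j < trace x (n + 1 - r) c \<or>
      e = down_edge r j \<and> trace x (n + 1 - r) c = j"
    by (auto simp: path_flow_def)
  have "n + 1 - (n + 1 - r) = r" using rj(1) by (auto simp: in_shape_def)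
  then show "x e > 0"
    using rj(2) trace_inside[OF rj(1), of x] exit_column_props[OF trace_active[OF rj(1)]] by auto
qed (use x_nonneg less_le in metis)

end

lemma card_vertices: "num_vertices n m a = card {\<pi>. vpp \<pi> \<and> entries \<pi> \<subseteq> {..<Suc m}}"
proof -
  let ?A = "{\<pi>. vpp \<pi> \<and> entries \<pi> \<subseteq> {..<Suc m}}" and ?B = "{x. is_vertex (flow_polytope n m a) x}"
  have le: "\<pi> i j \<le> m" if "\<pi> \<in> ?A" for \<pi> i j
  proof (cases "shape i j")
    case True
    then have "\<pi> i j \<in> entries \<pi>" by (auto simp: entries_def)
    then show ?thesis using that by auto
  next
    case False then show ?thesis using that vpp_outside[of \<pi> i j] by simp
  qed
  have B: "?B = {x. x \<in> flows (G_edges n m) (G_verts n m) (demand n a) \<and> confluent (G_edges n m) x}"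
    unfolding flow_polytope_eq vertex_iff_confluent ..
  have "bij_betw flow_of ?A ?B"
  proof (rule bij_betw_imageI)
    show "inj_on flow_of ?A" by (rule inj_onI) (use flow_of_inj in blast)
    show "flow_of ` ?A = ?B"
    proof
      show "flow_of ` ?A \<subseteq> ?B"
      proof (rule image_subsetI)
        fix \<pi> assume A: "\<pi> \<in> ?A"
        then have "vpp \<pi>" by simp
        then show "flow_of \<pi> \<in> ?B"
          unfolding B by (intro CollectI conjI flow_of_in_flows confluent_flow_of le[OF A])
      qed
      show "?B \<subseteq> flow_of ` ?A"
      proof
        fix x assume "x \<in> ?B"
        then have x: "x \<in> flows (G_edges n m) (G_verts n m) (demand n a)" "confluent (G_edges n m) x"
          unfolding B by auto
        have "trace x \<in> ?A"
          using trace_vpp[OF x] trace_le[OF x] unfolding entries_def less_Suc_eq_le by (auto simp: less_Suc_eq_le)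
        then show "x \<in> flow_of ` ?A" by (rule image_eqI[rotated]) (rule flow_of_trace[OF x, symmetric])
      qed
    qed
  qed
  then show ?thesis by (simp add: num_vertices_def bij_betw_same_card)
qed

subsection \<open>Standard tableaux of the shifted shape\<close>

definition shift :: "nat \<times> nat \<Rightarrow> nat \<times> nat" where
  "shift = (\<lambda>(i, c). (n + 2 - c - i, n + 1 - c))"

definition unshift :: "nat \<times> nat \<Rightarrow> nat \<times> nat" where
  "unshift = (\<lambda>(r, k). (k + 1 - r, n + 1 - k))"

lemma shifted_cells_iff:
  "(r, k) \<in> shifted_cells n a \<longleftrightarrow> r \<le> k \<and> k \<le> n \<and> shape (k + 1 - r) (n + 1 - k)"
proof -
  have "1 \<le> r" if "r \<le> k" "k \<le> n" "shape (k + 1 - r) (n + 1 - k)"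
    using shape_bound[OF that(3)] that by (cases r) auto
  then show ?thesis
    unfolding shifted_cells_def using shape_iff_lam_conj[of "n + 1 - k" "k + 1 - r"] by fastforce
qed

lemma shift_unshift: "p \<in> shifted_cells n a \<Longrightarrow> shift (unshift p) = p"
  by (cases p) (auto simp: shifted_cells_iff shift_def unshift_def)

lemma unshift_shift: "q \<in> cells \<Longrightarrow> unshift (shift q) = q"
  using shape_bound by (cases q) (fastforce simp: cells_def shift_def unshift_def in_shape_def)

lemma unshift_in: "p \<in> shifted_cells n a \<Longrightarrow> unshift p \<in> cells"
  by (cases p) (simp add: shifted_cells_iff cells_def unshift_def)

lemma shift_in: "q \<in> cells \<Longrightarrow> shift q \<in> shifted_cells n a"
proof -
  assume q: "q \<in> cells"
  obtain i c where ic: "q = (i, c)" by (cases q)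
  have s: "shape i c" using q ic by (simp add: cells_def)
  have b: "1 \<le> i" "1 \<le> c" "i + c \<le> n + 1" using shape_bound[OF s] s by (auto simp: in_shape_def)
  then have "n + 1 - c + 1 - (n + 2 - c - i) = i" "n + 1 - (n + 1 - c) = c" by auto
  moreover have "n + 2 - c - i \<le> n + 1 - c" "n + 1 - c \<le> n" using b by auto
  ultimately show ?thesis using s by (simp add: ic shift_def shifted_cells_iff)
qed

lemma bij_unshift: "bij_betw unshift (shifted_cells n a) cells"
  by (rule bij_betw_byWitness[where f' = shift])
     (auto simp: shift_unshift unshift_shift unshift_in shift_in)

lemma card_shifted_cells: "card (shifted_cells n a) = lam_size n a"
  using bij_betw_same_card[OF bij_unshift] card_cells by simp

definition tableau_of :: "(nat \<Rightarrow> nat \<Rightarrow> nat) \<Rightarrow> nat \<times> nat \<Rightarrow> nat" where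
  "tableau_of \<pi> p = (if p \<in> shifted_cells n a then Suc (case_prod \<pi> (unshift p)) else 0)"

definition partition_of :: "(nat \<times> nat \<Rightarrow> nat) \<Rightarrow> nat \<Rightarrow> nat \<Rightarrow> nat" where
  "partition_of T i c = (if shape i c then T (shift (i, c)) - 1 else 0)"

lemma distinct_entries:
  assumes "entries \<pi> = {..<lam_size n a}"
  shows "bij_betw (case_prod \<pi>) cells {..<lam_size n a}"
proof -
  have "card (case_prod \<pi> ` cells) = card cells" using assms by (simp add: entries_image[symmetric] card_cells)
  then have "inj_on (case_prod \<pi>) cells" using eq_card_imp_inj_on[OF finite_cells] by blast
  then show ?thesis using assms by (simp add: bij_betw_def entries_image)
qed

lemma tableau_of_SYT:
  assumes v: "vpp \<pi>" and e: "entries \<pi> = {..<lam_size n a}"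
  shows "tableau_of \<pi> \<in> SYT_shifted n a"
proof -
  let ?N = "lam_size n a" and ?S = "shifted_cells n a"
  have bij: "bij_betw (case_prod \<pi>) cells {..<?N}" using distinct_entries[OF e] .
  have ne: "\<pi> i j \<noteq> \<pi> i' j'" if "shape i j" "shape i' j'" "(i, j) \<noteq> (i', j')" for i j i' j'
    using bij_betw_imp_inj_on[OF bij] that unfolding inj_on_def cells_def by fastforce
  have "bij_betw (Suc \<circ> (case_prod \<pi> \<circ> unshift)) ?S {1..?N}"
  proof (rule bij_betw_trans[OF bij_betw_trans[OF bij_unshift bij]])
    show "bij_betw Suc {..<?N} {1..?N}" by (simp add: bij_betw_def lessThan_atLeast0 image_Suc_atLeastLessThan atLeastLessThanSuc_atLeastAtMost)
  qed
  moreover have "bij_betw (tableau_of \<pi>) ?S {1..?N} \<longleftrightarrow> bij_betw (Suc \<circ> (case_prod \<pi> \<circ> unshift)) ?S {1..?N}"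
    by (rule bij_betw_cong) (simp add: tableau_of_def)
  ultimately have bt: "bij_betw (tableau_of \<pi>) ?S {1..?N}" by blast
  have col: "tableau_of \<pi> (r, k) < tableau_of \<pi> (r', k)" if "(r, k) \<in> ?S" "(r', k) \<in> ?S" "r < r'" for r r' k
  proof -
    have anti: "i \<le> i' \<Longrightarrow> 1 \<le> i \<Longrightarrow> \<pi> i' c \<le> \<pi> i c" for i i' c
    proof (induction i' rule: dec_induct)
      case (step i') then show ?case using vpp_column[OF v, of i' c] by simp
    qed simp
    have s: "shape (k + 1 - r) (n + 1 - k)" "shape (k + 1 - r') (n + 1 - k)" "r' \<le> k"
      using that by (auto simp: shifted_cells_iff)
    then have "\<pi> (k + 1 - r) (n + 1 - k) < \<pi> (k + 1 - r') (n + 1 - k)"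
      using anti[of "k + 1 - r'" "k + 1 - r" "n + 1 - k"] ne[OF s(1,2)] that by fastforce
    then show ?thesis using that by (simp add: tableau_of_def unshift_def)
  qed
  have adjacent: "(r, Suc l) \<in> ?S \<and> tableau_of \<pi> (r, l) < tableau_of \<pi> (r, Suc l)"
    if l: "(r, l) \<in> ?S" "Suc l \<le> n" for r l
  proof -
    define c where "c = n - l"
    define i where "i = l + 1 - r"
    have eqs: "n + 1 - l = c + 1" "n + 1 - Suc l = c" "Suc l + 1 - r = i + 1" "1 \<le> c"
      using l by (auto simp: c_def i_def shifted_cells_iff)
    have s: "shape i (c + 1)" using l(1) unfolding shifted_cells_iff eqs i_def[symmetric] by blast
    note s1 = shape_diag[OF s eqs(4)] and s2 = shape_left[OF s eqs(4)]
    have S: "(r, Suc l) \<in> ?S" using l s1 unfolding shifted_cells_iff eqs by auto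
    have "\<pi> i (c + 1) \<noteq> \<pi> i c" using ne[OF s s2] by simp
    then have "\<pi> i (c + 1) < \<pi> (i + 1) c" using vpp_adjacent[OF v eqs(4) s] by simp
    moreover have "tableau_of \<pi> (r, l) = Suc (\<pi> i (c + 1))"
      using l(1) by (simp only: tableau_of_def unshift_def prod.case eqs(1) i_def if_True)
    moreover have "tableau_of \<pi> (r, Suc l) = Suc (\<pi> (i + 1) c)"
      using S by (simp only: tableau_of_def unshift_def prod.case eqs(2,3) if_True)
    ultimately show ?thesis using S by simp
  qed
  have row: "tableau_of \<pi> (r, k) < tableau_of \<pi> (r, k')" if "(r, k) \<in> ?S" "(r, k') \<in> ?S" "k < k'" for r k k'
  proof -
    have "k + 1 \<le> k'" "k' \<le> n" using that by (auto simp: shifted_cells_iff)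
    then have "(r, k') \<in> ?S \<and> tableau_of \<pi> (r, k) < tableau_of \<pi> (r, k')"
    proof (induction k' rule: dec_induct)
      case base then show ?case using adjacent[of r k] that by simp
    next
      case (step l) then show ?case using adjacent[of r l] by fastforce
    qed
    then show ?thesis ..
  qed
  show ?thesis
    unfolding SYT_shifted_def card_shifted_cells using bt row col by (auto simp: tableau_of_def)
qed

lemma partition_of_vpp:
  assumes T: "T \<in> SYT_shifted n a"
  shows "vpp (partition_of T)" "entries (partition_of T) = {..<lam_size n a}"
proof -
  let ?S = "shifted_cells n a" and ?N = "lam_size n a"
  have bij: "bij_betw T ?S {1..?N}" using T by (simp add: SYT_shifted_def card_shifted_cells)
  then have pos: "1 \<le> T p" if "p \<in> ?S" for p using that bij_betw_apply by fastforce
  have row: "T (r, k) < T (r, k')" if "(r, k) \<in> ?S" "(r, k') \<in> ?S" "k < k'" for r k k'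
    using T that unfolding SYT_shifted_def by blast
  have col: "T (r, k) < T (r', k)" if "(r, k) \<in> ?S" "(r', k) \<in> ?S" "r < r'" for r r' k
    using T that unfolding SYT_shifted_def by blast
  have sh: "shift (i, c) \<in> ?S" "i + c \<le> n + 1" "1 \<le> i" if "shape i c" for i c
    using shift_in[of "(i, c)"] shape_bound[OF that] that by (auto simp: cells_def in_shape_def)
  show "vpp (partition_of T)" unfolding vertex_plane_partition_iff
  proof (intro conjI allI impI)
    fix i j assume "\<not> shape i j" then show "partition_of T i j = 0" by (simp add: partition_of_def)
  next
    fix i j assume ij: "1 \<le> i \<and> shape (i + 1) j"
    then have s: "shape (i + 1) j" "shape i j" using shape_up by blast+
    have "T (shift (i + 1, j)) < T (shift (i, j))"
      using sh[OF s(1)] sh[OF s(2)] unfolding shift_def prod.case by (intro col) auto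
    then show "partition_of T (i + 1) j \<le> partition_of T i j" using s by (simp add: partition_of_def)
  next
    fix i j assume ij: "1 \<le> j \<and> shape i (j + 1)"
    then have s: "shape (i + 1) j" "shape i (j + 1)" using shape_diag by blast+
    have eq: "n + 2 - (j + 1) - i = n + 2 - j - (i + 1)" by simp
    have "T (shift (i, j + 1)) < T (shift (i + 1, j))"
      using sh[OF s(1)] sh[OF s(2)] unfolding shift_def prod.case eq by (intro row) auto
    then have "partition_of T i (j + 1) < partition_of T (i + 1) j"
      using s pos[OF sh(1)[OF s(1)]] pos[OF sh(1)[OF s(2)]] by (simp add: partition_of_def)
    then show "partition_of T i (j + 1) < partition_of T (i + 1) j \<or> partition_of T i (j + 1) = partition_of T i j" ..
  qed
  have "entries (partition_of T) = (\<lambda>q. T (shift q) - 1) ` cells"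
    unfolding entries_image by (rule image_cong) (auto simp: partition_of_def cells_def)
  also have "\<dots> = (\<lambda>p. T p - 1) ` ?S"
  proof -
    have "shift ` cells = ?S"
    proof
      show "shift ` cells \<subseteq> ?S" using shift_in by blast
      show "?S \<subseteq> shift ` cells" using unshift_in shift_unshift by (metis imageI subsetI)
    qed
    then show ?thesis using image_image[of "\<lambda>p. T p - 1" shift cells] by simp
  qed
  also have "\<dots> = (\<lambda>t. t - 1) ` {1..?N}" 
    unfolding bij_betw_imp_surj_on[OF bij, symmetric] by (simp add: image_image)
  also have "\<dots> = {..<?N}"
  proof
    show "{..<?N} \<subseteq> (\<lambda>t. t - 1) ` {1..?N}"
    proof
      fix t assume "t \<in> {..<?N}"
      then show "t \<in> (\<lambda>t. t - 1) ` {1..?N}" by (intro image_eqI[of _ _ "Suc t"]) auto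
    qed
  qed auto
  finally show "entries (partition_of T) = {..<?N}" .
qed

lemma p_count_eq_card_SYT: "p_count n a (lam_size n a) = card (SYT_shifted n a)"
proof -
  have "bij_betw tableau_of {\<pi>. vpp \<pi> \<and> entries \<pi> = {..<lam_size n a}} (SYT_shifted n a)"
  proof (rule bij_betw_byWitness[where f' = partition_of])
    show "\<forall>\<pi>\<in>{\<pi>. vpp \<pi> \<and> entries \<pi> = {..<lam_size n a}}. partition_of (tableau_of \<pi>) = \<pi>"
    proof clarify
      fix \<pi> assume v: "vpp \<pi>"
      show "partition_of (tableau_of \<pi>) = \<pi>"
      proof (intro ext)
        fix i c show "partition_of (tableau_of \<pi>) i c = \<pi> i c"
          using vpp_outside[OF v, of i c] shift_in[of "(i, c)"] unshift_shift[of "(i, c)"]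
          by (simp add: partition_of_def tableau_of_def cells_def)
      qed
    qed
    show "\<forall>T\<in>SYT_shifted n a. tableau_of (partition_of T) = T"
    proof (intro ballI ext)
      fix T p assume T: "T \<in> SYT_shifted n a"
      show "tableau_of (partition_of T) p = T p"
      proof (cases "p \<in> shifted_cells n a")
        case True
        have "bij_betw T (shifted_cells n a) {1..card (shifted_cells n a)}"
          using T by (simp add: SYT_shifted_def)
        from bij_betw_apply[OF this True] have "T p \<ge> 1" by simp
        moreover obtain i c where ic: "unshift p = (i, c)" by (cases "unshift p")
        moreover have "shape i c" "shift (i, c) = p"
          using unshift_in[OF True] shift_unshift[OF True] by (simp_all add: ic cells_def)
        ultimately show ?thesis using True by (simp add: tableau_of_def partition_of_def)
      next
        case False
        moreover have "T p = 0" using T False unfolding SYT_shifted_def by blast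
        ultimately show ?thesis by (simp add: tableau_of_def)
      qed
    qed
    show "tableau_of ` {\<pi>. vpp \<pi> \<and> entries \<pi> = {..<lam_size n a}} \<subseteq> SYT_shifted n a"
      using tableau_of_SYT by blast
    show "partition_of ` SYT_shifted n a \<subseteq> {\<pi>. vpp \<pi> \<and> entries \<pi> = {..<lam_size n a}}"
      using partition_of_vpp by blast
  qed
  then show ?thesis unfolding p_count_eq by (rule bij_betw_same_card)
qed

end

definition falling_poly :: "nat \<Rightarrow> real poly" where
  "falling_poly k = (\<Prod>i<k. [:1 - real i, 1:])"

lemma degree_falling_poly: "degree (falling_poly k) = k"
  unfolding falling_poly_def by (subst degree_prod_eq_sum_degree) auto

lemma coeff_falling_poly: "coeff (falling_poly k) k = 1"
proof -
  have "lead_coeff (falling_poly k) = 1" unfolding falling_poly_def lead_coeff_prod by simp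
  then show ?thesis by (simp add: degree_falling_poly)
qed

lemma poly_falling_poly: "poly (falling_poly k) (real m) = fact k * real (Suc m choose k)"
proof -
  have "poly (falling_poly k) (real m) = (\<Prod>i=0..<k. real (Suc m) - real i)"
    unfolding falling_poly_def poly_prod lessThan_atLeast0 by (rule prod.cong) auto
  then show ?thesis by (simp add: binomial_gbinomial gbinomial_prod_rev)
qed

theorem theorem5p40:
  fixes n :: nat and a :: "nat \<Rightarrow> nat"
  assumes "1 \<le> n"
    and "\<forall>i\<in>{1..n}. a i \<in> {0, 1}"
  shows "(\<exists>P :: real poly.
            (\<forall>\<^sub>F m in sequentially.
               poly P (real m) = fact (lam_size n a) * real (num_vertices n m a))
          \<and> degree P = lam_size n a
          \<and> coeff P (lam_size n a) = real (p_count n a (lam_size n a)))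
       \<and> p_count n a (lam_size n a) = card (SYT_shifted n a)"
proof -
  interpret zero_one_netflow n a
  proof
    show "a i \<le> 1" if "1 \<le> i" "i \<le> n" for i
      using assms(2)[rule_format, of i] that by auto
  qed (rule assms(1))
  define N where "N = lam_size n a"
  define P where "P = (\<Sum>k\<le>N. smult (fact N * real (p_count n a k) / fact k) (falling_poly k))"
  have "poly P (real m) = fact N * real (num_vertices n m a)" for m
    unfolding P_def card_vertices card_vpp_bounded N_def[symmetric]
    by (simp add: poly_sum poly_falling_poly sum_distrib_left algebra_simps)
  moreover have coeff: "coeff P N = real (p_count n a N)"
  proof -
    have "coeff P N = (\<Sum>k\<le>N. if k = N then real (p_count n a N) else 0)"
      unfolding P_def coeff_sum
      by (rule sum.cong) (auto simp: coeff_falling_poly coeff_eq_0 degree_falling_poly)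
    then show ?thesis by simp
  qed
  moreover have "degree P = N"
  proof (rule antisym)
    show "degree P \<le> N" unfolding P_def
      by (rule degree_sum_le) (auto simp: degree_falling_poly intro: order.trans[OF degree_smult_le])
    show "N \<le> degree P" using coeff p_count_lam_size_pos by (intro le_degree) (simp add: N_def)
  qed
  ultimately show ?thesis
    using p_count_eq_card_SYT unfolding N_def by (intro conjI exI[of _ P]) auto
qed

end
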